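(* Let $F$ be a field and let $\sigma_1,\ldots,\sigma_n$ be pairwise commuting automorphisms of $F$ such that $\bigcap_{i=1}^n F_{\sigma_i}$ is infinite. Then the tuple $(\sigma_1,\ldots,\sigma_n)$ is automorphically normalizable over $F$ if and only if $\sigma_1^{d_1}=\cdots=\sigma_n^{d_n}$ for some positive integers $d_1,\ldots,d_n$.
   Context: All rings are associative with unity. $F_\sigma=\{r\in F:\sigma(r)=r\}$. For commuting automorphisms $\sigma_1,\ldots,\sigma_n$ of $F$, $F[t_1,\ldots,t_n;\sigma_1,\ldots,\sigma_n]$ denotes the skew polynomial ring in pairwise commuting variables with $t_ia=\sigma_i(a)t_i$ for $a\in F$. For a ring $S\supseteq F$, $a\in S$ is automorphic over $F$ with respect to $\tau\in\mathrm{Aut}(F)$ if $ab=\tau(b)a$ for all $b\in F$. $S$ is finite over a subring $R$ if finitely generated as a left $R$-module. Commuting $a_1,\ldots,a_m\in S$ are (left) algebraically independent over $F$ if the monomials in them are left linearly independent over $F$. $S$ is automorphically normalizable over $F$ if there exist $m\ge0$ and commuting $a_1,\ldots,a_m\in S$, automorphic over $F$ with respect to pairwise commuting automorphisms, left algebraically independent over $F$, with $S$ finite over the subring $F[a_1,\ldots,a_m]$ generated by $F\cup\{a_1,\ldots,a_m\}$. The tuple $(\sigma_1,\ldots,\sigma_n)$ is automorphically normalizable over $F$ if every quotient of $F[t_1,\ldots,t_n;\sigma_1,\ldots,\sigma_n]$ by a proper two-sided ideal is automorphically normalizable over $F$. *)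

theory Defs
  imports "HOL-Algebra.Algebra"
begin

definition field_aut :: "('a::field \<Rightarrow> 'a) \<Rightarrow> bool" where
  "field_aut \<tau> \<longleftrightarrow> bij \<tau> \<and> (\<forall>x y. \<tau> (x + y) = \<tau> x + \<tau> y) \<and> (\<forall>x y. \<tau> (x * y) = \<tau> x * \<tau> y)"

fun sigma_pow :: "(nat \<Rightarrow> 'a \<Rightarrow> 'a) \<Rightarrow> nat \<Rightarrow> (nat \<Rightarrow> nat) \<Rightarrow> 'a \<Rightarrow> 'a" where
  "sigma_pow \<sigma> 0 \<alpha> = id"
| "sigma_pow \<sigma> (Suc k) \<alpha> = sigma_pow \<sigma> k \<alpha> \<circ> (\<sigma> k ^^ \<alpha> k)"

text \<open>Elements: finitely supported coefficient functions on exponent vectors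
  alpha :: nat => nat with alpha i = 0 for i >= n; p alpha is the coefficient of
  t^alpha = t_0^(alpha 0) ... t_(n-1)^(alpha (n-1)), coefficients written on the left.\<close>
definition skew_carrier :: "nat \<Rightarrow> ((nat \<Rightarrow> nat) \<Rightarrow> 'a::field) set" where
  "skew_carrier n = {p. finite {\<alpha>. p \<alpha> \<noteq> 0} \<and> (\<forall>\<alpha>. p \<alpha> \<noteq> 0 \<longrightarrow> (\<forall>i\<ge>n. \<alpha> i = 0))}"

text \<open>(a t^alpha)(b t^beta) = a sigma^alpha(b) t^(alpha+beta)\<close>
definition skew_mult :: "(nat \<Rightarrow> 'a::field \<Rightarrow> 'a) \<Rightarrow> nat \<Rightarrow>
    ((nat \<Rightarrow> nat) \<Rightarrow> 'a) \<Rightarrow> ((nat \<Rightarrow> nat) \<Rightarrow> 'a) \<Rightarrow> (nat \<Rightarrow> nat) \<Rightarrow> 'a" where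
  "skew_mult \<sigma> n p q \<gamma> =
     (\<Sum>\<alpha>\<in>{\<alpha>. p \<alpha> \<noteq> 0 \<and> (\<forall>i. \<alpha> i \<le> \<gamma> i)}. p \<alpha> * sigma_pow \<sigma> n \<alpha> (q (\<lambda>i. \<gamma> i - \<alpha> i)))"

definition skew_const :: "'a::field \<Rightarrow> (nat \<Rightarrow> nat) \<Rightarrow> 'a" where
  "skew_const c = (\<lambda>\<alpha>. if \<alpha> = (\<lambda>_. 0) then c else 0)"

definition skew_poly_ring :: "(nat \<Rightarrow> 'a::field \<Rightarrow> 'a) \<Rightarrow> nat \<Rightarrow> ((nat \<Rightarrow> nat) \<Rightarrow> 'a) ring" where
  "skew_poly_ring \<sigma> n =
     \<lparr> carrier = skew_carrier n,
       monoid.mult = skew_mult \<sigma> n,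
       one = skew_const 1,
       ring.zero = (\<lambda>_. 0),
       ring.add = (\<lambda>p q \<alpha>. p \<alpha> + q \<alpha>) \<rparr>"

definition automorphic :: "('b, 'c) ring_scheme \<Rightarrow> ('a::field \<Rightarrow> 'b) \<Rightarrow> 'b \<Rightarrow> ('a \<Rightarrow> 'a) \<Rightarrow> bool" where
  "automorphic S \<phi> a \<tau> \<longleftrightarrow> (\<forall>b. a \<otimes>\<^bsub>S\<^esub> \<phi> b = \<phi> (\<tau> b) \<otimes>\<^bsub>S\<^esub> a)"

fun monom_prod :: "('b, 'c) ring_scheme \<Rightarrow> (nat \<Rightarrow> 'b) \<Rightarrow> nat \<Rightarrow> (nat \<Rightarrow> nat) \<Rightarrow> 'b" where
  "monom_prod S a 0 \<alpha> = \<one>\<^bsub>S\<^esub>"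
| "monom_prod S a (Suc k) \<alpha> = monom_prod S a k \<alpha> \<otimes>\<^bsub>S\<^esub> (a k [^]\<^bsub>S\<^esub> \<alpha> k)"

definition left_alg_indep :: "('b, 'c) ring_scheme \<Rightarrow> ('a::field \<Rightarrow> 'b) \<Rightarrow> (nat \<Rightarrow> 'b) \<Rightarrow> nat \<Rightarrow> bool" where
  "left_alg_indep S \<phi> a m \<longleftrightarrow>
     (\<forall>c :: (nat \<Rightarrow> nat) \<Rightarrow> 'a.
        finite {\<alpha>. c \<alpha> \<noteq> 0} \<longrightarrow> (\<forall>\<alpha>. c \<alpha> \<noteq> 0 \<longrightarrow> (\<forall>i\<ge>m. \<alpha> i = 0)) \<longrightarrow>
        finsum S (\<lambda>\<alpha>. \<phi> (c \<alpha>) \<otimes>\<^bsub>S\<^esub> monom_prod S a m \<alpha>) {\<alpha>. c \<alpha> \<noteq> 0} = \<zero>\<^bsub>S\<^esub> \<longrightarrow>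
        (\<forall>\<alpha>. c \<alpha> = 0))"

definition finite_over :: "('b, 'c) ring_scheme \<Rightarrow> 'b set \<Rightarrow> bool" where
  "finite_over S R \<longleftrightarrow>
     (\<exists>G. finite G \<and> G \<subseteq> carrier S \<and>
        (\<forall>s\<in>carrier S. \<exists>r. (\<forall>g\<in>G. r g \<in> R) \<and> s = finsum S (\<lambda>g. r g \<otimes>\<^bsub>S\<^esub> g) G))"

definition aut_normalizable :: "('b, 'c) ring_scheme \<Rightarrow> ('a::field \<Rightarrow> 'b) \<Rightarrow> bool" where
  "aut_normalizable S \<phi> \<longleftrightarrow>
     (\<exists>(m::nat) (a :: nat \<Rightarrow> 'b) (\<tau> :: nat \<Rightarrow> 'a \<Rightarrow> 'a).
        (\<forall>i<m. a i \<in> carrier S) \<and>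
        (\<forall>i<m. \<forall>j<m. a i \<otimes>\<^bsub>S\<^esub> a j = a j \<otimes>\<^bsub>S\<^esub> a i) \<and>
        (\<forall>i<m. field_aut (\<tau> i)) \<and>
        (\<forall>i<m. \<forall>j<m. \<tau> i \<circ> \<tau> j = \<tau> j \<circ> \<tau> i) \<and>
        (\<forall>i<m. automorphic S \<phi> (a i) (\<tau> i)) \<and>
        left_alg_indep S \<phi> a m \<and>
        finite_over S (generate_ring S (range \<phi> \<union> a ` {..<m})))"

definition aut_normalizable_tuple :: "(nat \<Rightarrow> 'a::field \<Rightarrow> 'a) \<Rightarrow> nat \<Rightarrow> bool" where
  "aut_normalizable_tuple \<sigma> n \<longleftrightarrow>
     (\<forall>I. ideal I (skew_poly_ring \<sigma> n) \<and> I \<noteq> carrier (skew_poly_ring \<sigma> n) \<longrightarrow>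
        aut_normalizable (skew_poly_ring \<sigma> n Quot I)
          (\<lambda>c. I +>\<^bsub>skew_poly_ring \<sigma> n\<^esub> skew_const c))"

end

theory Submission
  imports Defs "HOL-Computational_Algebra.Polynomial"
begin

text \<open>If \<open>\<sigma>_i^d_i = \<tau>\<close> for all \<open>i\<close>, a quotient generated by \<open>x_1, \<dots>, x_n\<close> is finite over the subring generated
  by the \<open>x_i^d_i\<close>, which are all automorphic with respect to the same \<open>\<tau>\<close>. There Noether's argument works:
  \<open>\<tau>\<close>-fixed scalars commute with the generators, so for suitable \<open>\<lambda>_i\<close> in the infinite field \<open>F_\<tau>\<close> at which the
  leading form of an algebraic relation does not vanish, the linear substitution \<open>b_i = b'_i + \<lambda>_i y\<close> with \<open>b'_n = 0\<close>
  makes the relation monic in \<open>y\<close>.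

  Conversely, consider \<open>F[t_i, t_j; \<sigma>_i, \<sigma>_j] / (t_i t_j)\<close>. An automorphic element involving positive powers of both
  variables gives \<open>\<sigma>_i^p = \<sigma>_j^q\<close>. If there is none, each of \<open>a_1, \<dots>, a_m\<close> lies in \<open>F[t_i]\<close> or in \<open>F[t_j]\<close>. The
  quotient is not finite over \<open>F[t_i]\<close> nor over \<open>F[t_j]\<close>, so there are \<open>a\<close> and \<open>b\<close> of the two different kinds; with
  constant terms \<open>a_0\<close> and \<open>b_0\<close>, \<open>(a - a_0) (b - b_0) = 0\<close> contradicts algebraic independence.\<close>

section \<open>Left spans and integral extensions\<close>

text \<open>Sums are built one product at a time, so a generator may recur with different
  coefficients, and neither finiteness of \<open>G\<close> nor closure of \<open>B\<close> is built
  in. Closure properties thus become inductions; \<open>lspan_finsum\<close> collects the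
  coefficients when a single sum over \<open>G\<close> is wanted.\<close>

inductive_set lspan :: "('b, 'c) ring_scheme \<Rightarrow> 'b set \<Rightarrow> 'b set \<Rightarrow> 'b set"
  for S B G where
  zero: "\<zero>\<^bsub>S\<^esub> \<in> lspan S B G"
| add: "\<lbrakk>b \<in> B; g \<in> G; s \<in> lspan S B G\<rbrakk> \<Longrightarrow> (b \<otimes>\<^bsub>S\<^esub> g) \<oplus>\<^bsub>S\<^esub> s \<in> lspan S B G"

context ring
begin

lemma lspan_carrier:
  assumes "B \<subseteq> carrier R" "G \<subseteq> carrier R" "s \<in> lspan R B G"
  shows "s \<in> carrier R"
  using assms(3) by induction (use assms(1,2) in auto)

lemma lspan_base:
  assumes "B \<subseteq> carrier R" "G \<subseteq> carrier R" "b \<in> B" "g \<in> G"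
  shows "b \<otimes> g \<in> lspan R B G"
  using lspan.add[OF assms(3,4) lspan.zero, of R] assms by (simp add: subset_eq)

lemma lspan_add:
  assumes "B \<subseteq> carrier R" "G \<subseteq> carrier R" "s \<in> lspan R B G" "s' \<in> lspan R B G"
  shows "s \<oplus> s' \<in> lspan R B G"
  using assms(3)
proof induction
  case zero
  then show ?case using assms lspan_carrier[OF assms(1,2,4)] by simp
next
  case (add b g s)
  then have "b \<otimes> g \<oplus> (s \<oplus> s') \<in> lspan R B G" by (intro lspan.add)
  moreover have "b \<otimes> g \<in> carrier R" "s \<in> carrier R" "s' \<in> carrier R"
    using add assms lspan_carrier[OF assms(1,2)] by auto
  ultimately show ?case by (simp add: a_assoc)
qed

text \<open>One induction serves both left and right multiplication by a ring element: either map is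
  additive, so only its values on the products of a coefficient and a generator have to be
  controlled.\<close>

lemma lspan_additive_image:
  assumes "B \<subseteq> carrier R" "G \<subseteq> carrier R" "B' \<subseteq> carrier R" "G' \<subseteq> carrier R"
    and "s \<in> lspan R B G"
    and "f \<zero> = \<zero>"
    and "\<And>x y. x \<in> carrier R \<Longrightarrow> y \<in> carrier R \<Longrightarrow> f (x \<oplus> y) = f x \<oplus> f y"
    and "\<And>b g. b \<in> B \<Longrightarrow> g \<in> G \<Longrightarrow> f (b \<otimes> g) \<in> lspan R B' G'"
  shows "f s \<in> lspan R B' G'"
  using assms(5)
proof induction
  case zero
  then show ?case using assms lspan.zero[of R] by simp
next
  case (add b g s)
  have "b \<otimes> g \<in> carrier R" "s \<in> carrier R"
    using add assms lspan_carrier[OF assms(1,2)] by auto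
  then show ?case using add assms lspan_add by simp
qed

lemma lspan_mult_left:
  assumes "B \<subseteq> carrier R" "G \<subseteq> carrier R" "B' \<subseteq> carrier R" "G' \<subseteq> carrier R"
    and "s \<in> lspan R B G" "c \<in> carrier R"
    and "\<And>b g. b \<in> B \<Longrightarrow> g \<in> G \<Longrightarrow> c \<otimes> (b \<otimes> g) \<in> lspan R B' G'"
  shows "c \<otimes> s \<in> lspan R B' G'"
  by (rule lspan_additive_image[OF assms(1-5)]) (use assms(6,7) in \<open>simp_all add: r_distr\<close>)

lemma lspan_mult_right:
  assumes "B \<subseteq> carrier R" "G \<subseteq> carrier R" "B' \<subseteq> carrier R" "G' \<subseteq> carrier R"
    and "s \<in> lspan R B G" "c \<in> carrier R"
    and "\<And>b g. b \<in> B \<Longrightarrow> g \<in> G \<Longrightarrow> (b \<otimes> g) \<otimes> c \<in> lspan R B' G'"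
  shows "s \<otimes> c \<in> lspan R B' G'"
  by (rule lspan_additive_image[OF assms(1-5)]) (use assms(6,7) in \<open>simp_all add: l_distr\<close>)

lemma lspan_mono:
  assumes "B \<subseteq> carrier R" "G' \<subseteq> carrier R" "G \<subseteq> G'"
  shows "lspan R B G \<subseteq> lspan R B G'"
proof
  fix s assume "s \<in> lspan R B G"
  then show "s \<in> lspan R B G'"
    by induction (use assms in \<open>auto intro: lspan.intros\<close>)
qed

lemma lspan_scale:
  assumes "subring B R" "G \<subseteq> carrier R" "s \<in> lspan R B G" "c \<in> B"
  shows "c \<otimes> s \<in> lspan R B G"
proof (rule lspan_mult_left[OF _ assms(2) _ assms(2,3)])
  show B: "B \<subseteq> carrier R" by (rule subringE(1)[OF assms(1)])
  then show "B \<subseteq> carrier R" "c \<in> carrier R" using assms by auto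
  show "c \<otimes> (b \<otimes> g) \<in> lspan R B G" if "b \<in> B" "g \<in> G" for b g
    using lspan_base[OF B assms(2) subringE(6)[OF assms(1,4) that(1)] that(2)] that assms B
    by (simp add: m_assoc subset_eq)
qed

lemma lspan_minus:
  assumes "subring B R" "G \<subseteq> carrier R" "s \<in> lspan R B G"
  shows "\<ominus> s \<in> lspan R B G"
proof -
  have "\<ominus> \<one> \<in> B" using assms(1) by (intro subringE(5) subringE(3)) auto
  from lspan_scale[OF assms this] show ?thesis
    using lspan_carrier[OF subringE(1)[OF assms(1)] assms(2,3)] by (simp add: l_minus)
qed

text \<open>Transitivity of finite generation: each coefficient in \<open>B\<close> is expanded over
  \<open>C\<close>. Coefficients stand on the left, so the new generators are the products with
  \<open>h\<close> before \<open>g\<close>.\<close>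

lemma lspan_trans:
  assumes "C \<subseteq> carrier R" "B \<subseteq> carrier R" "G \<subseteq> carrier R" "H \<subseteq> carrier R"
    and "B \<subseteq> lspan R C H"
  shows "lspan R B G \<subseteq> lspan R C {h \<otimes> g | h g. h \<in> H \<and> g \<in> G}"
proof
  let ?HG = "{h \<otimes> g | h g. h \<in> H \<and> g \<in> G}"
  have HG: "?HG \<subseteq> carrier R" using assms by auto
  fix s assume "s \<in> lspan R B G"
  then show "s \<in> lspan R C ?HG"
  proof induction
    case (add b g s)
    have "b \<otimes> g \<in> lspan R C ?HG"
    proof (rule lspan_mult_right[OF assms(1,4,1) HG])
      show "b \<in> lspan R C H" "g \<in> carrier R" using add assms by auto
      show "c \<otimes> h \<otimes> g \<in> lspan R C ?HG" if "c \<in> C" "h \<in> H" for c h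
      proof -
        have "c \<otimes> (h \<otimes> g) \<in> lspan R C ?HG"
          using that add by (intro lspan_base[OF assms(1) HG]) auto
        then show ?thesis using that add assms by (simp add: m_assoc subset_eq)
      qed
    qed
    then show ?case using add by (intro lspan_add[OF assms(1) HG])
  qed (rule lspan.zero)
qed

text \<open>Passes to the coefficient functions that \<open>finite_over\<close> asks for. Recurring
  generators are merged by adding their coefficients, which is where \<open>B\<close> has to be a
  subring.\<close>

lemma lspan_finsum:
  assumes "subring B R" "G \<subseteq> carrier R" "finite G" "s \<in> lspan R B G"
  shows "\<exists>r. (\<forall>g\<in>G. r g \<in> B) \<and> s = (\<Oplus>g\<in>G. r g \<otimes> g)"
  using assms(4)
proof induction
  case zero
  have "(\<Oplus>g\<in>G. \<zero> \<otimes> g) = (\<Oplus>g\<in>G. \<zero>)"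
    using assms by (intro finsum_cong') auto
  then show ?case using subringE(2)[OF assms(1)] by (intro exI[of _ "\<lambda>_. \<zero>"]) simp
next
  case (add b g s)
  have B: "B \<subseteq> carrier R" by (rule subringE(1)[OF assms(1)])
  obtain r where r: "\<And>g. g \<in> G \<Longrightarrow> r g \<in> B" "s = (\<Oplus>g\<in>G. r g \<otimes> g)" using add.IH by auto
  define r' where "r' h = (if g = h then b else \<zero>)" for h
  have "(\<Oplus>h\<in>G. (r' h \<oplus> r h) \<otimes> h) = (\<Oplus>h\<in>G. (if g = h then b \<otimes> h else \<zero>) \<oplus> (r h \<otimes> h))"
    using assms add B r(1) by (intro finsum_cong') (auto simp: r'_def l_distr subset_eq)
  also have "\<dots> = (\<Oplus>h\<in>G. if g = h then b \<otimes> h else \<zero>) \<oplus> s"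
    unfolding r(2) using assms add B r(1) by (intro finsum_addf) (auto simp: subset_eq)
  also have "(\<Oplus>h\<in>G. if g = h then b \<otimes> h else \<zero>) = b \<otimes> g"
    using assms add B by (intro finsum_singleton) (auto simp: subset_eq)
  finally show ?case
    using r(1) add subringE(2)[OF assms(1)] subringE(7)[OF assms(1)]
    by (intro exI[of _ "\<lambda>h. r' h \<oplus> r h"]) (auto simp: r'_def)
qed

text \<open>The set \<open>M\<close> is only an additive group, so membership in \<open>M\<close> is
  not inductive under products. The induction shows instead that left multiplication by each
  generated element maps \<open>M\<close> into itself; applying this to the unit gives the
  inclusion.\<close>

lemma generate_ring_left_stable:
  assumes "H \<subseteq> carrier R" "M \<subseteq> carrier R"
    and "\<And>x y. x \<in> M \<Longrightarrow> y \<in> M \<Longrightarrow> x \<oplus> y \<in> M" "\<And>x. x \<in> M \<Longrightarrow> \<ominus> x \<in> M"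
    and "\<And>h m. h \<in> H \<Longrightarrow> m \<in> M \<Longrightarrow> h \<otimes> m \<in> M"
    and "\<one> \<in> M"
  shows "generate_ring R H \<subseteq> M"
proof
  fix s assume s: "s \<in> generate_ring R H"
  then have "\<forall>m\<in>M. s \<otimes> m \<in> M"
  proof induction
    case (a_inv h)
    then show ?case using assms generate_ring_in_carrier[OF assms(1)] by (auto simp: l_minus)
  next
    case (eng_add h1 h2)
    then show ?case using assms(2,3) generate_ring_in_carrier[OF assms(1)]
      by (auto simp: l_distr subset_eq)
  next
    case (eng_mult h1 h2)
    then show ?case using assms(2) generate_ring_in_carrier[OF assms(1)]
      by (auto simp: m_assoc subset_eq)
  qed (use assms in auto)
  then show "s \<in> M" using assms(6) generate_ring_in_carrier[OF assms(1) s] by fastforce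
qed

text \<open>Substitute for commutativity: if \<open>y\<close> can be moved to the right past every
  generator, at the cost of changing the coefficient, it can be moved past the whole generated
  subring.\<close>

lemma generate_ring_normalized:
  assumes "H \<subseteq> carrier R" "y \<in> carrier R"
    and "\<And>h. h \<in> H \<Longrightarrow> \<exists>r'\<in>generate_ring R H. y \<otimes> h = r' \<otimes> y"
    and "r \<in> generate_ring R H"
  shows "\<exists>r'\<in>generate_ring R H. y \<otimes> r = r' \<otimes> y"
  using assms(4)
proof induction
  case one
  then show ?case using assms(2) generate_ring.one[of R H] by force
next
  case (a_inv h)
  then obtain r' where "r' \<in> generate_ring R H" "y \<otimes> h = r' \<otimes> y" by auto
  then show ?case using assms a_inv generate_ring_in_carrier[OF assms(1)]
    by (intro bexI[of _ "\<ominus> r'"]) (auto simp: l_minus r_minus generate_ring.a_inv)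
next
  case (eng_add h1 h2)
  then obtain r1 r2 where "r1 \<in> generate_ring R H" "y \<otimes> h1 = r1 \<otimes> y"
    "r2 \<in> generate_ring R H" "y \<otimes> h2 = r2 \<otimes> y" by auto
  then show ?case using assms eng_add.hyps generate_ring_in_carrier[OF assms(1)]
    by (intro bexI[of _ "r1 \<oplus> r2"]) (auto simp: l_distr r_distr generate_ring.eng_add)
next
  case (eng_mult h1 h2)
  then obtain r1 r2 where r: "r1 \<in> generate_ring R H" "y \<otimes> h1 = r1 \<otimes> y"
    "r2 \<in> generate_ring R H" "y \<otimes> h2 = r2 \<otimes> y" by auto
  note c = assms(2) eng_mult.hyps[THEN generate_ring_in_carrier[OF assms(1)]]
     r(1,3)[THEN generate_ring_in_carrier[OF assms(1)]]
  have "y \<otimes> (h1 \<otimes> h2) = (y \<otimes> h1) \<otimes> h2" using c by (simp add: m_assoc)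
  also have "\<dots> = r1 \<otimes> (y \<otimes> h2)" using c r by (simp add: m_assoc)
  also have "\<dots> = (r1 \<otimes> r2) \<otimes> y" using c r by (simp add: m_assoc)
  finally show ?case using r by (intro bexI[of _ "r1 \<otimes> r2"]) (auto simp: generate_ring.eng_mult)
qed (use assms in auto)

text \<open>The last hypothesis is a monic equation of degree \<open>D\<close> for \<open>y\<close>
  over \<open>B\<close>. Since \<open>y\<close> moves past the coefficients, left multiplication by
  \<open>y\<close> raises the power of \<open>y\<close> by one, and the monic equation brings
  \<open>y [^] D\<close> back into the span. The span of the lower powers is therefore stable under
  \<open>B\<close> and \<open>y\<close> and contains the unit.\<close>

lemma integral_extension:
  assumes "subring B R" "y \<in> carrier R"
    and "\<And>r. r \<in> B \<Longrightarrow> \<exists>r'\<in>B. y \<otimes> r = r' \<otimes> y"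
    and "y [^] D \<in> lspan R B ((\<lambda>j::nat. y [^] j) ` {..<D})"
  shows "generate_ring R (insert y B) \<subseteq> lspan R B ((\<lambda>j. y [^] j) ` {..<D})"
proof -
  let ?G = "(\<lambda>j. y [^] j) ` {..<D}"
  have B: "B \<subseteq> carrier R" by (rule subringE(1)[OF assms(1)])
  have G: "?G \<subseteq> carrier R" using assms(2) by auto
  \<comment> \<open>The boundary case \<open>j = D\<close> is included: it absorbs the overshoot
    caused by one multiplication by \<open>y\<close>, and it supplies the unit even when
    \<open>D = 0\<close>.\<close>
  have pow: "b \<otimes> y [^] j \<in> lspan R B ?G" if "b \<in> B" "j \<le> D" for b j
    using that lspan_base[OF B G, of b "y [^] j"] lspan_scale[OF assms(1) G assms(4)]
    by (cases "j = D") auto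
  show ?thesis
  proof (rule generate_ring_left_stable)
    show "insert y B \<subseteq> carrier R" using B assms(2) by auto
    show "lspan R B ?G \<subseteq> carrier R" using lspan_carrier[OF B G] by auto
    show "\<one> \<in> lspan R B ?G" using pow[of \<one> 0] subringE(3)[OF assms(1)] by simp
    show "h \<otimes> m \<in> lspan R B ?G" if h: "h \<in> insert y B" and m: "m \<in> lspan R B ?G" for h m
    proof (cases "h \<in> B")
      case True
      then show ?thesis using lspan_scale[OF assms(1) G m] by simp
    next
      case False
      then have [simp]: "h = y" using h by simp
      show ?thesis unfolding \<open>h = y\<close>
      proof (rule lspan_mult_left[OF B G B G m assms(2)])
        fix b g assume b: "b \<in> B" and "g \<in> ?G"
        then obtain j where j: "j < D" "g = y [^] j" by auto
        obtain r' where r': "r' \<in> B" "y \<otimes> b = r' \<otimes> y" using assms(3)[OF b] by auto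
        have "y \<otimes> (b \<otimes> g) = (y \<otimes> b) \<otimes> g" using b B j assms(2) by (simp add: m_assoc subset_eq)
        also have "\<dots> = r' \<otimes> y [^] Suc j" unfolding r' nat_pow_Suc2[OF assms(2)]
          using r' B j assms(2) by (simp add: m_assoc subset_eq)
        also have "\<dots> \<in> lspan R B ?G" using j r' by (intro pow) auto
        finally show "y \<otimes> (b \<otimes> g) \<in> lspan R B ?G" .
      qed
    qed
  qed (use lspan_add[OF B G] lspan_minus[OF assms(1) G] in auto)
qed

end

section \<open>Noether normalization for a common automorphism\<close>

text \<open>A nonzero polynomial does not vanish identically on a power of an infinite subset
  \<open>K\<close> of the field. By induction on the number of variables, some coefficient with
  respect to the last variable is nonzero at a point of the others; what remains is a nonzero
  polynomial in one variable, with finitely many roots.\<close>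

lemma nonvanishing_point:
  fixes c :: "(nat \<Rightarrow> nat) \<Rightarrow> 'a::field"
  assumes "infinite K" "finite {\<alpha>. c \<alpha> \<noteq> 0}" "\<And>\<alpha> i. c \<alpha> \<noteq> 0 \<Longrightarrow> n \<le> i \<Longrightarrow> \<alpha> i = 0" "c \<alpha>0 \<noteq> 0"
  shows "\<exists>l. (\<forall>i. l i \<in> K) \<and> (\<Sum>\<alpha>\<in>{\<alpha>. c \<alpha> \<noteq> 0}. c \<alpha> * (\<Prod>i<n. l i ^ \<alpha> i)) \<noteq> 0"
  using assms(2-)
proof (induction n arbitrary: c \<alpha>0)
  case 0
  have eq: "\<alpha> = \<alpha>0" if "c \<alpha> \<noteq> 0" for \<alpha>
    using 0(2)[OF that] 0(2)[OF 0(3)] by (auto simp: fun_eq_iff)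
  then have "{\<alpha>. c \<alpha> \<noteq> 0} = {\<alpha>0}" using 0 by blast
  moreover obtain x where "x \<in> K" using assms(1) infinite_imp_nonempty by blast
  ultimately show ?case using 0 by (intro exI[of _ "\<lambda>_. x"]) simp
next
  case (Suc n)
  define A where "A = {\<alpha>. c \<alpha> \<noteq> 0}"
  define k where "k = \<alpha>0 n"
  \<comment> \<open>This is the coefficient of the \<open>k\<close>-th power of the last variable,
    as a polynomial in the others. Taking \<open>k\<close> from \<open>\<alpha>0\<close> makes it
    nonzero.\<close>
  define c' where "c' \<beta> = (if \<beta> n = 0 then c (\<beta>(n := k)) else 0)" for \<beta>
  have A: "finite A" using Suc unfolding A_def by simp
  have bij: "bij_betw (\<lambda>\<alpha>. \<alpha>(n := 0)) {\<alpha>\<in>A. \<alpha> n = k} {\<beta>. c' \<beta> \<noteq> 0}"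
    by (rule bij_betwI[where g = "\<lambda>\<beta>. \<beta>(n := k)"])
       (auto simp: A_def c'_def fun_eq_iff fun_upd_idem split: if_splits)
  have "\<exists>l. (\<forall>i. l i \<in> K) \<and> (\<Sum>\<beta>\<in>{\<beta>. c' \<beta> \<noteq> 0}. c' \<beta> * (\<Prod>i<n. l i ^ \<beta> i)) \<noteq> 0"
  proof (rule Suc.IH)
    show "finite {\<beta>. c' \<beta> \<noteq> 0}" using bij_betw_finite[OF bij] A by simp
    show "c' (\<alpha>0(n := 0)) \<noteq> 0" using Suc.prems by (simp add: c'_def k_def)
    show "\<beta> i = 0" if "c' \<beta> \<noteq> 0" "n \<le> i" for \<beta> i
    proof (cases "i = n")
      case False
      moreover have "c (\<beta>(n := k)) \<noteq> 0" using that by (auto simp: c'_def split: if_splits)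
      ultimately show ?thesis using Suc.prems(2)[of "\<beta>(n := k)" i] that(2) by (simp del: fun_upd_apply add: fun_upd_other)
    qed (use that in \<open>auto simp: c'_def split: if_splits\<close>)
  qed
  then obtain l where l: "\<And>i. l i \<in> K" "(\<Sum>\<beta>\<in>{\<beta>. c' \<beta> \<noteq> 0}. c' \<beta> * (\<Prod>i<n. l i ^ \<beta> i)) \<noteq> 0"
    by auto
  \<comment> \<open>The polynomial with its first \<open>n\<close> variables specialized to
    \<open>l\<close>. Its \<open>k\<close>-th coefficient is the value of \<open>c'\<close> at
    \<open>l\<close>, hence nonzero.\<close>
  define P where "P = (\<Sum>\<alpha>\<in>A. Polynomial.monom (c \<alpha> * (\<Prod>i<n. l i ^ \<alpha> i)) (\<alpha> n))"
  have "Polynomial.coeff P k = (\<Sum>\<alpha>\<in>A. if \<alpha> n = k then c \<alpha> * (\<Prod>i<n. l i ^ \<alpha> i) else 0)"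
    unfolding P_def by (simp add: Polynomial.coeff_sum)
  also have "\<dots> = (\<Sum>\<alpha>\<in>{\<alpha>\<in>A. \<alpha> n = k}. c \<alpha> * (\<Prod>i<n. l i ^ \<alpha> i))"
    using A by (simp add: sum.inter_filter)
  also have "\<dots> = (\<Sum>\<alpha>\<in>{\<alpha>\<in>A. \<alpha> n = k}. c' (\<alpha>(n := 0)) * (\<Prod>i<n. l i ^ (\<alpha>(n := 0)) i))"
    by (intro sum.cong) (auto simp: c'_def)
  also have "\<dots> = (\<Sum>\<beta>\<in>{\<beta>. c' \<beta> \<noteq> 0}. c' \<beta> * (\<Prod>i<n. l i ^ \<beta> i))"
    by (rule sum.reindex_bij_betw[OF bij])
  finally have "P \<noteq> 0" using l(2) by auto
  then have "finite {x. poly P x = 0}" by (rule poly_roots_finite)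
  then have "infinite (K - {x. poly P x = 0})" using assms(1) by simp
  then have "K - {x. poly P x = 0} \<noteq> {}" by (rule infinite_imp_nonempty)
  then obtain x where x: "x \<in> K" "poly P x \<noteq> 0" by blast
  have "poly P x = (\<Sum>\<alpha>\<in>A. c \<alpha> * (\<Prod>i<Suc n. (l(n := x)) i ^ \<alpha> i))"
    unfolding P_def poly_sum by (intro sum.cong) (auto simp: poly_monom mult.assoc)
  then show ?case using x l(1) unfolding A_def by (intro exI[of _ "l(n := x)"]) auto
qed

text \<open>The scalars need not be central, so this is weaker than an algebra over the field.
  Nontriviality makes \<open>\<phi>\<close> injective, because a nonzero scalar is
  invertible.\<close>

locale ring_over_field = ring R for R :: "('b, 'c) ring_scheme" (structure) +
  fixes \<phi> :: "'a::field \<Rightarrow> 'b"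
  assumes hom_closed [simp, intro]: "\<phi> x \<in> carrier R"
    and hom_add: "\<phi> (x + y) = \<phi> x \<oplus> \<phi> y"
    and hom_mult: "\<phi> (x * y) = \<phi> x \<otimes> \<phi> y"
    and hom_one [simp]: "\<phi> 1 = \<one>"
    and nontrivial: "\<one> \<noteq> \<zero>"
begin

lemma hom_zero [simp]: "\<phi> 0 = \<zero>"
  using hom_add[of 0 0] by (metis add.l_cancel_one' add_0 hom_closed)

lemma hom_minus: "\<phi> (- x) = \<ominus> \<phi> x"
  using hom_add[of "- x" x] by (simp add: minus_equality)

lemma hom_eq_zero: "\<phi> x = \<zero> \<Longrightarrow> x = 0"
  using hom_mult[of "inverse x" x] nontrivial by (cases "x = 0") auto

text \<open>All elements share one automorphism, whereas \<open>aut_normalizable\<close> allows a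
  different one for each. Sharing is what keeps linear combinations with fixed scalars
  automorphic.\<close>

definition commuting_system :: "(nat \<Rightarrow> 'b) \<Rightarrow> nat \<Rightarrow> ('a \<Rightarrow> 'a) \<Rightarrow> bool" where
  "commuting_system b m \<tau> \<longleftrightarrow> (\<forall>i<m. b i \<in> carrier R) \<and>
     (\<forall>i<m. \<forall>j<m. b i \<otimes> b j = b j \<otimes> b i) \<and> (\<forall>i<m. automorphic R \<phi> (b i) \<tau>)"

abbreviation gen :: "(nat \<Rightarrow> 'b) \<Rightarrow> nat \<Rightarrow> 'b set" where
  "gen b m \<equiv> generate_ring R (range \<phi> \<union> b ` {..<m})"

text \<open>A dependence relation of total degree \<open>D\<close> is rewritten in powers of
  \<open>y\<close> over the ring generated by the \<open>b' i\<close>. Its coefficient at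
  \<open>y [^] D\<close> is the leading form evaluated at the point \<open>l\<close>; once this is
  nonzero, \<open>y\<close> satisfies a monic equation and \<open>integral_extension\<close>
  applies.\<close>

lemma noether_step:
  assumes sys: "commuting_system b (Suc k) \<tau>" and aut: "field_aut \<tau>" and inf: "infinite {x. \<tau> x = x}"
    and dep: "\<not> left_alg_indep R \<phi> b (Suc k)"
  shows "\<exists>b' G. commuting_system b' k \<tau> \<and> finite G \<and> G \<subseteq> carrier R \<and>
           gen b (Suc k) \<subseteq> lspan R (gen b' k) G"
proof -
  let ?n = "Suc k"
  have bc [simp]: "b i \<in> carrier R" if "i < ?n" for i
    using sys that by (auto simp: commuting_system_def)
  have bcomm: "b i \<otimes> b j = b j \<otimes> b i" if "i < ?n" "j < ?n" for i j
    using sys that by (auto simp: commuting_system_def)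
  have baut: "b i \<otimes> \<phi> x = \<phi> (\<tau> x) \<otimes> b i" if "i < ?n" for i x
    using sys that by (auto simp: commuting_system_def automorphic_def)
  have \<tau>_mult: "\<tau> (x * y) = \<tau> x * \<tau> y" for x y using aut by (auto simp: field_aut_def)
  obtain c \<alpha>0 where c: "finite {\<alpha>. c \<alpha> \<noteq> 0}" "\<And>\<alpha> i. c \<alpha> \<noteq> 0 \<Longrightarrow> ?n \<le> i \<Longrightarrow> \<alpha> i = 0"
      "(\<Oplus>\<alpha>\<in>{\<alpha>. c \<alpha> \<noteq> 0}. \<phi> (c \<alpha>) \<otimes> monom_prod R b ?n \<alpha>) = \<zero>" "c \<alpha>0 \<noteq> 0"
    using dep unfolding left_alg_indep_def by blast
  define deg where "deg \<alpha> = (\<Sum>i<?n. \<alpha> i)" for \<alpha> :: "nat \<Rightarrow> nat"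
  define D where "D = Max (deg ` {\<alpha>. c \<alpha> \<noteq> 0})"
  have D: "deg \<alpha> \<le> D" if "c \<alpha> \<noteq> 0" for \<alpha>
    unfolding D_def using c(1) that by (intro Max_ge) auto
  have "D \<in> deg ` {\<alpha>. c \<alpha> \<noteq> 0}" unfolding D_def using c(1,4) by (intro Max_in) auto
  then obtain \<alpha>1 where \<alpha>1: "c \<alpha>1 \<noteq> 0" "deg \<alpha>1 = D" by auto
  \<comment> \<open>The leading form: the homogeneous part of degree \<open>D\<close>, which is
    nonzero because of \<open>\<alpha>1\<close>.\<close>
  define c' where "c' \<alpha> = (if deg \<alpha> = D then c \<alpha> else 0)" for \<alpha>
  have c'_sub: "{\<alpha>. c' \<alpha> \<noteq> 0} \<subseteq> {\<alpha>. c \<alpha> \<noteq> 0}" by (auto simp: c'_def)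
  \<comment> \<open>Zero is removed from the fixed field so that \<open>l k\<close> can be inverted
    in the definition of \<open>y\<close>.\<close>
  have "\<exists>l. (\<forall>i. l i \<in> {x. \<tau> x = x} - {0}) \<and>
       (\<Sum>\<alpha>\<in>{\<alpha>. c' \<alpha> \<noteq> 0}. c' \<alpha> * (\<Prod>i<?n. l i ^ \<alpha> i)) \<noteq> 0"
  proof (rule nonvanishing_point)
    show "infinite ({x. \<tau> x = x} - {0})" using inf by simp
    show "finite {\<alpha>. c' \<alpha> \<noteq> 0}" using finite_subset[OF c'_sub c(1)] .
    show "c' \<alpha>1 \<noteq> 0" using \<alpha>1 by (simp add: c'_def)
    show "\<alpha> i = 0" if "c' \<alpha> \<noteq> 0" "?n \<le> i" for \<alpha> i using c(2) that c'_sub by blast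
  qed
  then obtain l where l_fix: "\<And>i. \<tau> (l i) = l i" and l_nz: "\<And>i. l i \<noteq> 0"
    and l: "(\<Sum>\<alpha>\<in>{\<alpha>. c' \<alpha> \<noteq> 0}. c' \<alpha> * (\<Prod>i<?n. l i ^ \<alpha> i)) \<noteq> 0" by auto
  \<comment> \<open>Obtained by applying \<open>\<tau>\<close> to the product of 1 with the nonzero
    fixed element \<open>l 0\<close>. It makes the inverses of the \<open>l i\<close> fixed as
    well.\<close>
  have "\<tau> 1 = 1"
    using \<tau>_mult[of 1 "l 0"] l_fix[of 0] l_nz[of 0] by auto
  then have li_fix: "\<tau> (inverse (l i)) = inverse (l i)" for i
    using \<tau>_mult[of "inverse (l i)" "l i"] l_nz[of i] l_fix[of i]
    by (intro inverse_unique[symmetric]) (simp add: mult.commute)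
  have "\<tau> 0 = 0" "\<tau> (x + y) = \<tau> x + \<tau> y" for x y
    using aut unfolding field_aut_def by (metis add_cancel_right_right, blast)
  then have "\<tau> (- l i) + l i = 0" for i by (metis l_fix ab_left_minus)
  then have lm_fix: "\<tau> (- l i) = - l i" for i by (simp add: eq_neg_iff_add_eq_0)

  \<comment> \<open>This normalization makes \<open>b' k\<close> vanish, so only \<open>k\<close>
    new elements remain. Scalars fixed by \<open>\<tau>\<close> commute with \<open>y\<close> and
    with every \<open>b i\<close>, so the \<open>b' i\<close> still commute and are still
    automorphic with respect to \<open>\<tau>\<close>.\<close>
  define y where "y = \<phi> (inverse (l k)) \<otimes> b k"
  define b' where "b' i = b i \<oplus> \<phi> (- l i) \<otimes> y" for i
  have [simp]: "y \<in> carrier R" by (simp add: y_def)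
  have b'c [simp]: "b' i \<in> carrier R" if "i < ?n" for i using that by (simp add: b'_def)
  have fix_comm: "b i \<otimes> \<phi> x = \<phi> x \<otimes> b i" if "i < ?n" "\<tau> x = x" for i x
    using baut[OF that(1), of x] that(2) by simp
  have b_y: "b i \<otimes> y = y \<otimes> b i" if i: "i < ?n" for i
  proof -
    have "b i \<otimes> y = (b i \<otimes> \<phi> (inverse (l k))) \<otimes> b k" using i by (simp add: y_def m_assoc)
    also have "\<dots> = \<phi> (inverse (l k)) \<otimes> (b i \<otimes> b k)"
      using i by (simp add: fix_comm li_fix m_assoc)
    also have "\<dots> = y \<otimes> b i" using i by (simp add: bcomm[of i k] y_def m_assoc)
    finally show ?thesis .
  qed
  have y\<phi>: "y \<otimes> \<phi> x = \<phi> (\<tau> x) \<otimes> y" for x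
  proof -
    have "y \<otimes> \<phi> x = \<phi> (inverse (l k)) \<otimes> (b k \<otimes> \<phi> x)" by (simp add: y_def m_assoc)
    also have "\<dots> = (\<phi> (inverse (l k)) \<otimes> \<phi> (\<tau> x)) \<otimes> b k" by (simp add: baut m_assoc)
    also have "\<dots> = (\<phi> (\<tau> x) \<otimes> \<phi> (inverse (l k))) \<otimes> b k"
      by (metis hom_mult mult.commute)
    also have "\<dots> = \<phi> (\<tau> x) \<otimes> y" by (simp add: y_def m_assoc)
    finally show ?thesis .
  qed
  have \<phi>y_comm: "z \<otimes> (\<phi> (- l i) \<otimes> y) = (\<phi> (- l i) \<otimes> y) \<otimes> z"
    if "z \<in> carrier R" "z \<otimes> y = y \<otimes> z" "z \<otimes> \<phi> (- l i) = \<phi> (- l i) \<otimes> z" for z i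
  proof -
    have "z \<otimes> (\<phi> (- l i) \<otimes> y) = (z \<otimes> \<phi> (- l i)) \<otimes> y" using that(1) by (simp add: m_assoc)
    also have "\<dots> = \<phi> (- l i) \<otimes> (z \<otimes> y)" unfolding that(3) using that(1) by (simp add: m_assoc)
    also have "\<dots> = (\<phi> (- l i) \<otimes> y) \<otimes> z" unfolding that(2) using that(1) by (simp add: m_assoc)
    finally show ?thesis .
  qed
  have b'y: "b' i \<otimes> y = y \<otimes> b' i" if "i < ?n" for i
    using that \<phi>y_comm[of y i] y\<phi>[of "- l i"]
    by (simp add: b'_def l_distr r_distr b_y lm_fix)
  have b'b: "b' i \<otimes> b j = b j \<otimes> b' i" if "i < ?n" "j < ?n" for i j
    using that \<phi>y_comm[of "b j" i] by (simp add: b'_def l_distr r_distr b_y bcomm[of i j] lm_fix fix_comm)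
  have b'\<phi>: "b' i \<otimes> \<phi> x = \<phi> (\<tau> x) \<otimes> b' i" if "i < ?n" for i x
  proof -
    have "\<phi> (- l i) \<otimes> y \<otimes> \<phi> x = (\<phi> (- l i) \<otimes> \<phi> (\<tau> x)) \<otimes> y" by (simp add: m_assoc y\<phi>)
    also have "\<dots> = \<phi> (\<tau> x) \<otimes> (\<phi> (- l i) \<otimes> y)"
      by (metis hom_mult mult.commute m_assoc hom_closed \<open>y \<in> carrier R\<close>)
    finally show ?thesis using that by (simp add: b'_def l_distr r_distr baut)
  qed
  have b'b': "b' i \<otimes> b' j = b' j \<otimes> b' i" if "i < ?n" "j < ?n" for i j
  proof -
    have "b' i \<otimes> b' j = b' i \<otimes> b j \<oplus> b' i \<otimes> (\<phi> (- l j) \<otimes> y)"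
      using that by (simp add: b'_def[of j] r_distr)
    also have "\<dots> = b j \<otimes> b' i \<oplus> (\<phi> (- l j) \<otimes> y) \<otimes> b' i"
      using that b'b \<phi>y_comm[of "b' i" j] b'y b'\<phi>[of i "- l j"] by (simp add: lm_fix)
    also have "\<dots> = b' j \<otimes> b' i" using that by (simp add: b'_def[of j] l_distr)
    finally show ?thesis .
  qed
  have b_eq: "b i = b' i \<oplus> \<phi> (l i) \<otimes> y" if "i < ?n" for i
    using that by (simp add: b'_def a_assoc l_distr[symmetric] hom_add[symmetric])
  have "\<phi> (l k) \<otimes> y = b k"
    using l_nz[of k] unfolding y_def by (simp add: m_assoc[symmetric] hom_mult[symmetric])
  then have "b' k = \<zero>" by (simp add: b'_def hom_minus l_minus r_neg)
  define B where "B = gen b' k"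
  have sub: "range \<phi> \<union> b' ` {..<k} \<subseteq> carrier R" by auto
  have B: "subring B R" unfolding B_def by (rule generate_ring_is_subring[OF sub])
  have Bc: "B \<subseteq> carrier R" by (rule subringE(1)[OF B])
  have b'B: "b' i \<in> B" if "i < ?n" for i
    using that \<open>b' k = \<zero>\<close> subringE(2)[OF B]
    by (cases "i = k") (auto simp: B_def intro!: generate_ring.incl)
  have \<phi>B: "\<phi> x \<in> B" for x unfolding B_def by (auto intro!: generate_ring.incl)
  define G where "G j = (\<lambda>i::nat. y [^] i) ` {..<j}" for j :: nat
  define M where "M j = lspan R B (G j)" for j
  have Gc: "G j \<subseteq> carrier R" for j by (auto simp: G_def)
  have Mc: "x \<in> carrier R" if "x \<in> M j" for x j
    using lspan_carrier[OF Bc Gc] that by (auto simp: M_def)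
  have M_add: "x \<oplus> x' \<in> M j" if "x \<in> M j" "x' \<in> M j" for x x' j
    using that lspan_add[OF Bc Gc] by (auto simp: M_def)
  have M_scale: "r \<otimes> x \<in> M j" if "x \<in> M j" "r \<in> B" for x r j
    using that lspan_scale[OF B Gc] by (auto simp: M_def)
  have M_base: "r \<otimes> y [^] i \<in> M j" if "r \<in> B" "i < j" for r and i j :: nat
    using that lspan_base[OF Bc Gc, of r "y [^] i" j] by (auto simp: M_def G_def)
  have M_mono: "x \<in> M j" if "x \<in> M i" "i \<le> j" for x i j
  proof -
    have "G i \<subseteq> G j" unfolding G_def using that(2) by (intro image_mono) auto
    from lspan_mono[OF Bc Gc this] show ?thesis using that(1) by (auto simp: M_def)
  qed
  have pow_comm: "y [^] i \<otimes> w = w \<otimes> y [^] i" if "w \<in> carrier R" "w \<otimes> y = y \<otimes> w" for w and i :: nat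
    using that group_commutes_pow[of y w i] by simp
  have M_right: "x \<otimes> w \<in> M j" if "x \<in> M j" "w \<in> B" "w \<otimes> y = y \<otimes> w" for x w j
    unfolding M_def
  proof (rule lspan_mult_right[OF Bc Gc[of j] Bc Gc[of j]])
    show "x \<in> lspan R B (G j)" "w \<in> carrier R" using that Bc by (auto simp: M_def)
    fix r g assume r: "r \<in> B" and "g \<in> G j"
    then obtain i where i: "i < j" "g = y [^] i" by (auto simp: G_def)
    have "r \<otimes> g \<otimes> w = (r \<otimes> w) \<otimes> y [^] i"
      using r i that Bc pow_comm[of w i] by (simp add: m_assoc subset_eq)
    then show "r \<otimes> g \<otimes> w \<in> lspan R B (G j)"
      using M_base[OF subringE(6)[OF B r that(2)] i(1)] by (simp add: M_def)
  qed
  have M_right_y: "x \<otimes> y \<in> M (Suc j)" if "x \<in> M j" for x j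
    unfolding M_def
  proof (rule lspan_mult_right[OF Bc Gc[of j] Bc Gc[of "Suc j"]])
    show "x \<in> lspan R B (G j)" "y \<in> carrier R" using that by (auto simp: M_def)
    fix r g assume r: "r \<in> B" and "g \<in> G j"
    then obtain i where i: "i < j" "g = y [^] i" by (auto simp: G_def)
    have "r \<otimes> g \<otimes> y = r \<otimes> y [^] Suc i" using r i Bc by (simp add: m_assoc subset_eq)
    then show "r \<otimes> g \<otimes> y \<in> lspan R B (G (Suc j))"
      using M_base[OF r, of "Suc i" "Suc j"] i(1) by (simp add: M_def)
  qed
  \<comment> \<open>Records that \<open>z\<close> equals \<open>u\<close> times the
    \<open>j\<close>-th power of \<open>y\<close> modulo lower powers of \<open>y\<close> with
    coefficients in \<open>B\<close> on the left.\<close>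
  define lead where "lead z u j \<longleftrightarrow> (\<exists>m\<in>M j. z = \<phi> u \<otimes> y [^] j \<oplus> m)" for z u j
  \<comment> \<open>Expand \<open>b i\<close> as \<open>b' i\<close> plus \<open>l i\<close> times
    \<open>y\<close>. The first summand does not raise the degree in \<open>y\<close>; the second
    raises it by one and multiplies the leading coefficient by \<open>l i\<close>, with no twist
    because \<open>l i\<close> commutes with \<open>y\<close>.\<close>
  have lead_step: "lead (z \<otimes> b i) (u * l i) (Suc j)" if z: "lead z u j" and i: "i < ?n" for z u i j
  proof -
    obtain m where m: "m \<in> M j" "z = \<phi> u \<otimes> y [^] j \<oplus> m" using z by (auto simp: lead_def)
    note [simp] = Mc[OF m(1)]
    have l_comm: "\<phi> (l i) \<otimes> y = y \<otimes> \<phi> (l i)" using y\<phi>[of "l i"] l_fix by simp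
    have "\<phi> u \<otimes> y [^] j \<otimes> b' i = (\<phi> u \<otimes> b' i) \<otimes> y [^] j"
      using i pow_comm[OF b'c[OF i] b'y[OF i]] by (simp add: m_assoc)
    then have 1: "\<phi> u \<otimes> y [^] j \<otimes> b' i \<in> M (Suc j)"
      using M_base[OF subringE(6)[OF B \<phi>B b'B[OF i]], of j "Suc j"] by simp
    have 2: "m \<otimes> b' i \<in> M (Suc j)"
      using M_mono[OF M_right[OF m(1) b'B[OF i] b'y[OF i]]] by simp
    have 3: "m \<otimes> \<phi> (l i) \<otimes> y \<in> M (Suc j)"
      using M_right_y[OF M_right[OF m(1) \<phi>B l_comm]] .
    have "\<phi> u \<otimes> y [^] j \<otimes> (\<phi> (l i) \<otimes> y) = \<phi> u \<otimes> (y [^] j \<otimes> \<phi> (l i)) \<otimes> y"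
      by (simp add: m_assoc)
    also have "\<dots> = \<phi> (u * l i) \<otimes> y [^] Suc j"
      using pow_comm[OF _ l_comm] by (simp add: hom_mult m_assoc)
    finally have 4: "\<phi> u \<otimes> y [^] j \<otimes> (\<phi> (l i) \<otimes> y) = \<phi> (u * l i) \<otimes> y [^] Suc j" .
    have "z \<otimes> b i = \<phi> u \<otimes> y [^] j \<otimes> (\<phi> (l i) \<otimes> y) \<oplus>
        (\<phi> u \<otimes> y [^] j \<otimes> b' i \<oplus> (m \<otimes> b' i \<oplus> m \<otimes> \<phi> (l i) \<otimes> y))"
      unfolding m(2) b_eq[OF i] using i by (simp add: l_distr r_distr a_ac m_assoc)
    then show ?thesis unfolding lead_def 4 using M_add[OF 1 M_add[OF 2 3]] by blast
  qed
  have lead_c: "z \<in> carrier R" if "lead z u j" for z u j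
    using that Mc by (auto simp: lead_def)
  have lead_pow: "lead (z \<otimes> b i [^] p) (u * l i ^ p) (j + p)" if "lead z u j" "i < ?n" for z u i j and p :: nat
  proof (induction p)
    case 0
    then show ?case using that lead_c[OF that(1)] by simp
  next
    case (Suc p)
    from lead_step[OF Suc that(2)] show ?case
      using that lead_c[OF that(1)] by (simp add: m_assoc mult_ac)
  qed
  have lead_monom: "lead (monom_prod R b r \<alpha>) (\<Prod>i<r. l i ^ \<alpha> i) (\<Sum>i<r. \<alpha> i)" if "r \<le> ?n" for r \<alpha>
    using that
  proof (induction r)
    case 0
    show ?case unfolding lead_def M_def
      using lspan.zero[of R B "G 0"] by (intro bexI[of _ "\<zero>"]) auto
  next
    case (Suc r)
    then show ?case using lead_pow[of _ _ _ r "\<alpha> r"] by simp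
  qed
  \<comment> \<open>Partial values of the leading form at \<open>l\<close>, so that the relation can
    be summed up by induction over finite sets of exponents.\<close>
  define v where "v A = (\<Sum>\<alpha>\<in>A. c' \<alpha> * (\<Prod>i<?n. l i ^ \<alpha> i))" for A
  have total: "\<exists>m\<in>M D. (\<Oplus>\<alpha>\<in>A. \<phi> (c \<alpha>) \<otimes> monom_prod R b ?n \<alpha>) = \<phi> (v A) \<otimes> y [^] D \<oplus> m"
    if "finite A" "A \<subseteq> {\<alpha>. c \<alpha> \<noteq> 0}" for A
    using that
  proof (induction A)
    case empty
    show ?case using lspan.zero[of R B "G D"] by (intro bexI[of _ \<zero>]) (auto simp: v_def M_def)
  next
    case (insert \<alpha> A)
    have mc: "monom_prod R b ?n \<beta> \<in> carrier R" for \<beta> using lead_c[OF lead_monom[OF order_refl]] .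
    obtain m where m: "m \<in> M D" "(\<Oplus>\<alpha>\<in>A. \<phi> (c \<alpha>) \<otimes> monom_prod R b ?n \<alpha>) = \<phi> (v A) \<otimes> y [^] D \<oplus> m"
      using insert by auto
    obtain m' where m': "m' \<in> M (deg \<alpha>)"
      "monom_prod R b ?n \<alpha> = \<phi> (\<Prod>i<?n. l i ^ \<alpha> i) \<otimes> y [^] deg \<alpha> \<oplus> m'"
      using lead_monom[OF order_refl, of \<alpha>] by (auto simp: lead_def deg_def)
    have "deg \<alpha> \<le> D" using insert D by auto
    have "\<exists>m''\<in>M D. \<phi> (c \<alpha>) \<otimes> monom_prod R b ?n \<alpha> = \<phi> (c' \<alpha> * (\<Prod>i<?n. l i ^ \<alpha> i)) \<otimes> y [^] D \<oplus> m''"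
    proof (cases "deg \<alpha> = D")
      case True
      have "\<phi> (c \<alpha>) \<otimes> m' \<in> M D" using M_scale[OF m'(1) \<phi>B] True by simp
      moreover have "\<phi> (c \<alpha>) \<otimes> monom_prod R b ?n \<alpha> =
          \<phi> (c' \<alpha> * (\<Prod>i<?n. l i ^ \<alpha> i)) \<otimes> y [^] D \<oplus> \<phi> (c \<alpha>) \<otimes> m'"
        unfolding m'(2) using True Mc[OF m'(1)]
        by (simp add: c'_def hom_mult r_distr m_assoc del: prod.lessThan_Suc)
      ultimately show ?thesis by blast
    next
      \<comment> \<open>A monomial of degree below \<open>D\<close> lies in \<open>M D\<close>
        altogether; accordingly \<open>c'\<close> contributes nothing to the leading
        coefficient.\<close>
      case False
      then have lt: "deg \<alpha> < D" using \<open>deg \<alpha> \<le> D\<close> by simp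
      have "monom_prod R b ?n \<alpha> \<in> M D"
        unfolding m'(2) using M_base[OF \<phi>B lt] M_mono[OF m'(1)] lt by (intro M_add) auto
      then have "\<phi> (c \<alpha>) \<otimes> monom_prod R b ?n \<alpha> \<in> M D" by (intro M_scale \<phi>B)
      then show ?thesis using False mc[of \<alpha>]
        by (intro bexI[of _ "\<phi> (c \<alpha>) \<otimes> monom_prod R b ?n \<alpha>"]) (auto simp: c'_def simp del: monom_prod.simps)
    qed
    then obtain m'' where m'': "m'' \<in> M D"
      "\<phi> (c \<alpha>) \<otimes> monom_prod R b ?n \<alpha> = \<phi> (c' \<alpha> * (\<Prod>i<?n. l i ^ \<alpha> i)) \<otimes> y [^] D \<oplus> m''" by auto
    have "(\<Oplus>\<alpha>\<in>insert \<alpha> A. \<phi> (c \<alpha>) \<otimes> monom_prod R b ?n \<alpha>) =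
        \<phi> (c \<alpha>) \<otimes> monom_prod R b ?n \<alpha> \<oplus> (\<Oplus>\<alpha>\<in>A. \<phi> (c \<alpha>) \<otimes> monom_prod R b ?n \<alpha>)"
      using insert mc by (intro finsum_insert) (auto simp del: monom_prod.simps)
    also have "\<dots> = \<phi> (v (insert \<alpha> A)) \<otimes> y [^] D \<oplus> (m'' \<oplus> m)"
      unfolding m(2) m''(2) using Mc[OF m(1)] Mc[OF m''(1)] insert(1,2)
      by (simp add: v_def hom_add l_distr a_ac del: prod.lessThan_Suc)
    finally show ?case using M_add[OF m''(1) m(1)] by blast
  qed
  \<comment> \<open>The value of the whole leading form, nonzero by the choice of \<open>l\<close>.
    Dividing the relation by \<open>u\<close> expresses \<open>y [^] D\<close> through lower
    powers.\<close>
  define u where "u = v {\<alpha>. c \<alpha> \<noteq> 0}"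
  have "u = v {\<alpha>. c' \<alpha> \<noteq> 0}"
    unfolding u_def v_def using c(1) c'_sub by (intro sum.mono_neutral_right) auto
  then have "u \<noteq> 0" using l by (simp add: v_def)
  obtain m where m: "m \<in> M D" "\<phi> u \<otimes> y [^] D \<oplus> m = \<zero>"
    using total[OF c(1) order_refl] c(3) unfolding u_def by auto
  have "y [^] D = \<phi> (inverse u) \<otimes> (\<phi> u \<otimes> y [^] D)"
    using \<open>u \<noteq> 0\<close> by (simp add: m_assoc[symmetric] hom_mult[symmetric])
  also have "\<phi> u \<otimes> y [^] D = \<ominus> m" using m Mc[OF m(1)] by (simp add: minus_equality)
  also have "\<phi> (inverse u) \<otimes> \<ominus> m = \<phi> (- inverse u) \<otimes> m"
    using Mc[OF m(1)] by (simp add: hom_minus l_minus r_minus)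
  finally have yD: "y [^] D \<in> M D" using M_scale[OF m(1) \<phi>B] by simp
  have norm: "\<exists>r'\<in>B. y \<otimes> r = r' \<otimes> y" if "r \<in> B" for r
    unfolding B_def
  proof (rule generate_ring_normalized[OF sub _ _ that[unfolded B_def]])
    fix h assume "h \<in> range \<phi> \<union> b' ` {..<k}"
    then consider x where "h = \<phi> x" | i where "i < k" "h = b' i" by auto
    then show "\<exists>r'\<in>gen b' k. y \<otimes> h = r' \<otimes> y"
    proof cases
      case 1
      then show ?thesis using y\<phi> \<phi>B unfolding B_def by blast
    next
      case (2 i)
      then show ?thesis using b'y[of i] b'B[of i] by (auto simp: B_def intro!: bexI[of _ "b' i"])
    qed
  qed simp
  have ext: "generate_ring R (insert y B) \<subseteq> M D"
    unfolding M_def G_def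
    using integral_extension[OF B _ norm yD[unfolded M_def G_def]] by simp
  have ins: "insert y B \<subseteq> carrier R" using Bc by auto
  have "gen b ?n \<subseteq> generate_ring R (insert y B)"
  proof (rule generate_ring_min_subring1[OF _ generate_ring_is_subring[OF ins]])
    show "range \<phi> \<union> b ` {..<?n} \<subseteq> carrier R" by auto
    have "b i \<in> generate_ring R (insert y B)" if "i < ?n" for i
      unfolding b_eq[OF that] using b'B[OF that] \<phi>B
      by (intro generate_ring.eng_add generate_ring.eng_mult generate_ring.incl) auto
    then show "range \<phi> \<union> b ` {..<?n} \<subseteq> generate_ring R (insert y B)"
      using generate_ring.incl[of _ "insert y B"] \<phi>B by auto
  qed
  then have "gen b ?n \<subseteq> lspan R (gen b' k) (G D)" using ext by (auto simp: M_def B_def)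
  moreover have "commuting_system b' k \<tau>"
    using b'b' b'\<phi> by (auto simp: commuting_system_def automorphic_def)
  moreover have "finite (G D)" by (simp add: G_def)
  ultimately show ?thesis using Gc by blast
qed

text \<open>As long as the elements are dependent, \<open>noether_step\<close> removes one of them,
  and the finite spans compose by \<open>lspan_trans\<close>. The process ends at the latest with no
  elements, where independence amounts to injectivity of \<open>\<phi>\<close>.\<close>

lemma noether_normalization:
  assumes "commuting_system b n \<tau>" "field_aut \<tau>" "infinite {x. \<tau> x = x}"
  shows "\<exists>m b' G. commuting_system b' m \<tau> \<and> left_alg_indep R \<phi> b' m \<and> finite G \<and> G \<subseteq> carrier R \<and>
           gen b n \<subseteq> lspan R (gen b' m) G"
  using assms(1)
proof (induction n arbitrary: b)
  case 0
  have "left_alg_indep R \<phi> b 0"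
    unfolding left_alg_indep_def
  proof (intro allI impI, rule ccontr)
    fix c :: "(nat \<Rightarrow> nat) \<Rightarrow> 'a" and \<alpha>
    assume c: "\<forall>\<alpha>. c \<alpha> \<noteq> 0 \<longrightarrow> (\<forall>i\<ge>0. \<alpha> i = 0)"
      and sum: "(\<Oplus>\<alpha>\<in>{\<alpha>. c \<alpha> \<noteq> 0}. \<phi> (c \<alpha>) \<otimes> monom_prod R b 0 \<alpha>) = \<zero>" and "c \<alpha> \<noteq> 0"
    have "\<beta> = \<alpha>" if "c \<beta> \<noteq> 0" for \<beta>
    proof
      fix i show "\<beta> i = \<alpha> i" using c that \<open>c \<alpha> \<noteq> 0\<close> by (metis le0)
    qed
    then have "{\<alpha>. c \<alpha> \<noteq> 0} = {\<alpha>}" using \<open>c \<alpha> \<noteq> 0\<close> by blast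
    with sum have "\<phi> (c \<alpha>) = \<zero>" by simp
    with hom_eq_zero \<open>c \<alpha> \<noteq> 0\<close> show False by blast
  qed
  moreover have "gen b 0 \<subseteq> lspan R (gen b 0) {\<one>}"
    using lspan_base[of "gen b 0" "{\<one>}" _ \<one>] generate_ring_incl[of "range \<phi> \<union> b ` {..<0}"]
    by fastforce
  ultimately show ?case using 0 by (intro exI[of _ 0] exI[of _ b] exI[of _ "{\<one>}"]) simp
next
  case (Suc k)
  show ?case
  proof (cases "left_alg_indep R \<phi> b (Suc k)")
    case True
    have "range \<phi> \<union> b ` {..<Suc k} \<subseteq> carrier R" using Suc.prems by (auto simp: commuting_system_def)
    from generate_ring_incl[OF this] have "gen b (Suc k) \<subseteq> lspan R (gen b (Suc k)) {\<one>}"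
      using lspan_base[of "gen b (Suc k)" "{\<one>}" _ \<one>] by fastforce
    then show ?thesis using Suc.prems True
      by (intro exI[of _ "Suc k"] exI[of _ b] exI[of _ "{\<one>}"]) simp
  next
    case False
    obtain b' G where b': "commuting_system b' k \<tau>" and G: "finite G" "G \<subseteq> carrier R"
      "gen b (Suc k) \<subseteq> lspan R (gen b' k) G"
      using noether_step[OF Suc.prems assms(2,3) False] by blast
    obtain m b'' H where b'': "commuting_system b'' m \<tau>" "left_alg_indep R \<phi> b'' m"
      and H: "finite H" "H \<subseteq> carrier R" "gen b' k \<subseteq> lspan R (gen b'' m) H"
      using Suc.IH[OF b'] by blast
    have "gen b' k \<subseteq> carrier R" "gen b'' m \<subseteq> carrier R"
      using b' b'' by (auto simp: commuting_system_def intro!: generate_ring_incl)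
    from lspan_trans[OF this(2,1) G(2) H(2,3)] G(3)
    have "gen b (Suc k) \<subseteq> lspan R (gen b'' m) {h \<otimes> g |h g. h \<in> H \<and> g \<in> G}" by blast
    moreover have "finite {h \<otimes> g |h g. h \<in> H \<and> g \<in> G}"
      using G(1) H(1) by (intro finite_image_set2) auto
    moreover have "{h \<otimes> g |h g. h \<in> H \<and> g \<in> G} \<subseteq> carrier R" using G(2) H(2) by auto
    ultimately show ?thesis using b'' by blast
  qed
qed

section \<open>Passing from automorphic elements to their powers\<close>

lemma automorphic_pow:
  assumes "x \<in> carrier R" "automorphic R \<phi> x \<tau>"
  shows "automorphic R \<phi> (x [^] (d::nat)) (\<tau> ^^ d)"
proof (induction d)
  case (Suc d)
  have "x [^] Suc d \<otimes> \<phi> c = \<phi> ((\<tau> ^^ Suc d) c) \<otimes> x [^] Suc d" for c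
  proof -
    have "x [^] Suc d \<otimes> \<phi> c = x [^] d \<otimes> (x \<otimes> \<phi> c)" using assms by (simp add: m_assoc)
    also have "x \<otimes> \<phi> c = \<phi> (\<tau> c) \<otimes> x" using assms by (simp add: automorphic_def)
    also have "x [^] d \<otimes> (\<phi> (\<tau> c) \<otimes> x) = (x [^] d \<otimes> \<phi> (\<tau> c)) \<otimes> x" using assms by (simp add: m_assoc)
    also have "x [^] d \<otimes> \<phi> (\<tau> c) = \<phi> ((\<tau> ^^ d) (\<tau> c)) \<otimes> x [^] d" using Suc by (simp add: automorphic_def)
    finally show ?thesis using assms by (simp add: m_assoc funpow_swap1)
  qed
  then show ?case by (simp add: automorphic_def)
qed (simp add: automorphic_def)

text \<open>The generators are replaced by their powers one at a time: in \<open>b k\<close> the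
  first \<open>k\<close> of them have been replaced. Putting back \<open>x k\<close> is an integral
  extension, because \<open>x k\<close> is a root of a monic equation whose constant term involves
  its own \<open>d k\<close>-th power.\<close>

lemma finite_over_powers:
  fixes \<sigma> :: "nat \<Rightarrow> 'a \<Rightarrow> 'a"
  assumes x: "\<And>i. i < n \<Longrightarrow> x i \<in> carrier R"
    and comm: "\<And>i j. i < n \<Longrightarrow> j < n \<Longrightarrow> x i \<otimes> x j = x j \<otimes> x i"
    and aut: "\<And>i. i < n \<Longrightarrow> automorphic R \<phi> (x i) (\<sigma> i)"
    and d: "\<And>i. i < n \<Longrightarrow> 0 < (d i :: nat)"
  shows "\<exists>G. finite G \<and> G \<subseteq> carrier R \<and> gen x n \<subseteq> lspan R (gen (\<lambda>i. x i [^] d i) n) G"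
proof -
  define b where "b k i = (if i < k then x i [^] d i else x i)" for k i
  have bc: "b k i \<in> carrier R" if "i < n" for k i using x that by (simp add: b_def)
  then have sub: "range \<phi> \<union> b k ` {..<n} \<subseteq> carrier R" for k by auto
  have "\<exists>G. finite G \<and> G \<subseteq> carrier R \<and> gen x n \<subseteq> lspan R (gen (b k) n) G" if "k \<le> n" for k
    using that
  proof (induction k)
    case 0
    have "gen (b 0) n \<subseteq> lspan R (gen (b 0) n) {\<one>}"
      using lspan_base[of "gen (b 0) n" "{\<one>}" _ \<one>] generate_ring_incl[OF sub[of 0]] by fastforce
    moreover have "b 0 = x" by (auto simp: b_def)
    ultimately show ?case by (intro exI[of _ "{\<one>}"]) auto
  next
    case (Suc k)
    then have k: "k < n" by simp
    obtain G where G: "finite G" "G \<subseteq> carrier R" "gen x n \<subseteq> lspan R (gen (b k) n) G"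
      using Suc by auto
    define B where "B = gen (b (Suc k)) n"
    let ?P = "(\<lambda>j. x k [^] j) ` {..<d k}"
    have B: "subring B R" unfolding B_def by (rule generate_ring_is_subring[OF sub])
    note Bc = subringE(1)[OF B]
    have bB: "b (Suc k) i \<in> B" if "i < n" for i
      unfolding B_def using that by (auto intro!: generate_ring.incl)
    have \<phi>B: "\<phi> c \<in> B" for c unfolding B_def by (auto intro!: generate_ring.incl)
    have "x k [^] d k \<in> B" using bB[OF k] by (simp add: b_def)
    have "?P \<subseteq> carrier R" using x k by auto
    \<comment> \<open>The power \<open>x k [^] d k\<close> is itself a coefficient, multiplied by
      the generator \<open>x k [^] 0\<close>. That generator is available because \<open>d k\<close>
      is positive.\<close>
    from lspan_base[OF Bc this \<open>x k [^] d k \<in> B\<close>, of "x k [^] (0::nat)"]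
    have pow: "x k [^] d k \<in> lspan R B ?P" using x[OF k] d[OF k] by (force simp del: nat_pow_0 simp: nat_pow_0)
    have norm: "\<exists>r'\<in>B. x k \<otimes> r = r' \<otimes> x k" if r: "r \<in> B" for r
      unfolding B_def
    proof (rule generate_ring_normalized[OF sub x[OF k] _ r[unfolded B_def]])
      fix h assume "h \<in> range \<phi> \<union> b (Suc k) ` {..<n}"
      then consider c where "h = \<phi> c" | i where "i < n" "h = b (Suc k) i" by auto
      then show "\<exists>r'\<in>gen (b (Suc k)) n. x k \<otimes> h = r' \<otimes> x k"
      proof cases
        case 1
        then show ?thesis using aut[OF k] \<phi>B by (auto simp: automorphic_def B_def)
      next
        case (2 i)
        have "x k \<otimes> x i [^] d i = x i [^] d i \<otimes> x k"
          using group_commutes_pow[of "x i" "x k" "d i"] comm 2 k x by simp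
        then have "x k \<otimes> h = h \<otimes> x k" using 2 k comm by (simp add: b_def)
        then show ?thesis using bB 2 by (auto simp: B_def)
      qed
    qed
    have ins: "insert (x k) B \<subseteq> carrier R" using Bc x k by auto
    have "b k i \<in> insert (x k) B" if "i < n" for i
      using bB[OF that] by (cases "i = k") (auto simp: b_def less_Suc_eq)
    then have "range \<phi> \<union> b k ` {..<n} \<subseteq> generate_ring R (insert (x k) B)"
      using generate_ring.incl[of _ "insert (x k) B"] \<phi>B by fastforce
    then have "gen (b k) n \<subseteq> generate_ring R (insert (x k) B)"
      by (intro generate_ring_min_subring1 generate_ring_is_subring sub ins)
    also have "\<dots> \<subseteq> lspan R B ?P"
      by (rule integral_extension[OF B x[OF k] norm pow])
    finally have "gen (b k) n \<subseteq> lspan R B ?P" .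
    from lspan_trans[OF Bc generate_ring_incl[OF sub] G(2) _ this] G(3)
    have "gen x n \<subseteq> lspan R B {h \<otimes> g |h g. h \<in> ?P \<and> g \<in> G}" using x k by auto
    moreover have "finite {h \<otimes> g |h g. h \<in> ?P \<and> g \<in> G}"
      using G(1) by (intro finite_image_set2) auto
    moreover have "{h \<otimes> g |h g. h \<in> ?P \<and> g \<in> G} \<subseteq> carrier R" using G(2) x k by auto
    ultimately show ?case unfolding B_def by blast
  qed
  from this[of n] have "\<exists>G. finite G \<and> G \<subseteq> carrier R \<and> gen x n \<subseteq> lspan R (gen (b n) n) G" by simp
  moreover have "b n ` {..<n} = (\<lambda>i. x i [^] d i) ` {..<n}" by (auto simp: b_def)
  ultimately show ?thesis by simp
qed

text \<open>The powers \<open>x i [^] d i\<close> form a \<open>commuting_system\<close> for the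
  single automorphism \<open>\<tau>\<close>. Finiteness over them is composed with finiteness over
  the independent elements found by \<open>noether_normalization\<close>.\<close>

lemma aut_normalizable_of_equal_powers:
  fixes \<sigma> :: "nat \<Rightarrow> 'a \<Rightarrow> 'a"
  assumes x: "\<And>i. i < n \<Longrightarrow> x i \<in> carrier R"
    and comm: "\<And>i j. i < n \<Longrightarrow> j < n \<Longrightarrow> x i \<otimes> x j = x j \<otimes> x i"
    and aut: "\<And>i. i < n \<Longrightarrow> automorphic R \<phi> (x i) (\<sigma> i)"
    and d: "\<And>i. i < n \<Longrightarrow> 0 < (d i :: nat)"
    and \<tau>: "\<And>i. i < n \<Longrightarrow> \<sigma> i ^^ d i = \<tau>" "field_aut \<tau>" "infinite {c. \<tau> c = c}"
    and gen: "carrier R \<subseteq> gen x n"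
  shows "aut_normalizable R \<phi>"
proof -
  let ?y = "\<lambda>i. x i [^] d i"
  obtain G where G: "finite G" "G \<subseteq> carrier R" "gen x n \<subseteq> lspan R (gen ?y n) G"
    using finite_over_powers[of n x \<sigma> d, OF x comm aut d] by auto
  have "commuting_system ?y n \<tau>"
    unfolding commuting_system_def
  proof (intro conjI allI impI)
    fix i j assume ij: "i < n" "j < n"
    have "x i [^] d i \<otimes> x j = x j \<otimes> x i [^] d i"
      using group_commutes_pow[of "x i" "x j" "d i"] ij x comm by simp
    then show "?y i \<otimes> ?y j = ?y j \<otimes> ?y i"
      using group_commutes_pow[of "x j" "?y i" "d j"] ij x by simp
  next
    fix i assume i: "i < n"
    then show "automorphic R \<phi> (?y i) \<tau>"
      using automorphic_pow[OF x[OF i] aut[OF i], of "d i"] \<tau>(1) by simp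
  qed (use x in simp)
  then obtain m b H where b: "commuting_system b m \<tau>" "left_alg_indep R \<phi> b m"
    and H: "finite H" "H \<subseteq> carrier R" "gen ?y n \<subseteq> lspan R (gen b m) H"
    using noether_normalization \<tau>(2,3) by blast
  have sub: "range \<phi> \<union> b ` {..<m} \<subseteq> carrier R" using b by (auto simp: commuting_system_def)
  have "gen ?y n \<subseteq> carrier R" using x by (intro generate_ring_incl) auto
  from lspan_trans[OF generate_ring_incl[OF sub] this G(2) H(2,3)] G(3) gen
  have *: "carrier R \<subseteq> lspan R (gen b m) {h \<otimes> g |h g. h \<in> H \<and> g \<in> G}" by blast
  have fin: "finite {h \<otimes> g |h g. h \<in> H \<and> g \<in> G}"
    using G(1) H(1) by (intro finite_image_set2) auto
  have c: "{h \<otimes> g |h g. h \<in> H \<and> g \<in> G} \<subseteq> carrier R" using G(2) H(2) by auto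
  have "finite_over R (gen b m)"
    unfolding finite_over_def
    using lspan_finsum[OF generate_ring_is_subring[OF sub] c fin] * fin c
    by (intro exI[of _ "{h \<otimes> g |h g. h \<in> H \<and> g \<in> G}"]) blast
  then show ?thesis
    unfolding aut_normalizable_def using b \<tau>(2)
    by (intro exI[of _ m] exI[of _ b] exI[of _ "\<lambda>_. \<tau>"]) (auto simp: commuting_system_def)
qed

end

section \<open>Skew polynomial rings\<close>

definition skew_monom :: "(nat \<Rightarrow> nat) \<Rightarrow> 'a \<Rightarrow> (nat \<Rightarrow> nat) \<Rightarrow> 'a::field" where
  "skew_monom \<alpha> c = (\<lambda>\<beta>. if \<beta> = \<alpha> then c else 0)"

text \<open>The exponent vector of the \<open>k\<close>-th power of the variable with index
  \<open>i\<close>.\<close>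

definition single_exp :: "nat \<Rightarrow> nat \<Rightarrow> nat \<Rightarrow> nat" where
  "single_exp i k = (\<lambda>j. if j = i then k else 0)"

locale commuting_auts =
  fixes \<sigma> :: "nat \<Rightarrow> 'a::field \<Rightarrow> 'a" and n :: nat
  assumes aut: "i < n \<Longrightarrow> field_aut (\<sigma> i)"
    and comm: "i < n \<Longrightarrow> j < n \<Longrightarrow> \<sigma> i \<circ> \<sigma> j = \<sigma> j \<circ> \<sigma> i"
begin

abbreviation exps :: "(nat \<Rightarrow> nat) set" where "exps \<equiv> {\<alpha>. \<forall>i\<ge>n. \<alpha> i = 0}"

abbreviation "\<Sigma> \<equiv> sigma_pow \<sigma> n"

lemma funpow_aut:
  assumes "i < n"
  shows "(\<sigma> i ^^ k) (x + y) = (\<sigma> i ^^ k) x + (\<sigma> i ^^ k) y"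
    "(\<sigma> i ^^ k) (x * y) = (\<sigma> i ^^ k) x * (\<sigma> i ^^ k) y"
  using aut[OF assms] by (induction k) (auto simp: field_aut_def)

lemma sigma_pow_hom:
  "r \<le> n \<Longrightarrow> sigma_pow \<sigma> r \<alpha> (x + y) = sigma_pow \<sigma> r \<alpha> x + sigma_pow \<sigma> r \<alpha> y"
  "r \<le> n \<Longrightarrow> sigma_pow \<sigma> r \<alpha> (x * y) = sigma_pow \<sigma> r \<alpha> x * sigma_pow \<sigma> r \<alpha> y"
  by (induction r arbitrary: x y) (auto simp: funpow_aut)

lemma sigma_pow_bij: "r \<le> n \<Longrightarrow> bij (sigma_pow \<sigma> r \<alpha>)"
proof (induction r)
  case (Suc r)
  have "bij (\<sigma> r ^^ \<alpha> r)" using aut[of r] Suc.prems by (intro bij_betw_funpow) (auto simp: field_aut_def)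
  then show ?case using Suc unfolding sigma_pow.simps by (intro bij_comp) simp_all
qed simp

lemma Sigma_aut: "field_aut (\<Sigma> \<alpha>)"
  using sigma_pow_hom[OF order_refl] sigma_pow_bij by (auto simp: field_aut_def)

lemma Sigma_add: "\<Sigma> \<alpha> (x + y) = \<Sigma> \<alpha> x + \<Sigma> \<alpha> y"
  and Sigma_mult: "\<Sigma> \<alpha> (x * y) = \<Sigma> \<alpha> x * \<Sigma> \<alpha> y"
  by (simp_all add: sigma_pow_hom)

lemma Sigma_0 [simp]: "\<Sigma> \<alpha> 0 = 0"
  using Sigma_add[of \<alpha> 0 0] by (metis add_0 add_right_imp_eq)

lemma Sigma_1 [simp]: "\<Sigma> \<alpha> 1 = 1"
proof -
  have "\<Sigma> \<alpha> 1 \<noteq> 0"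
    using bij_is_inj[OF sigma_pow_bij[OF order_refl], of \<alpha>] by (metis Sigma_0 injD zero_neq_one)
  then show ?thesis using Sigma_mult[of \<alpha> 1 1] by simp
qed

lemma Sigma_sum: "\<Sigma> \<alpha> (sum f A) = (\<Sum>x\<in>A. \<Sigma> \<alpha> (f x))"
  by (induction A rule: infinite_finite_induct) (auto simp: Sigma_add)

lemma funpow_commute:
  assumes "f \<circ> g = g \<circ> f"
  shows "(f ^^ k) \<circ> g = g \<circ> (f ^^ k)"
  using assms by (induction k) (auto simp: fun_eq_iff)

lemma sigma_pow_funpow_commute:
  assumes "r \<le> n" "j < n"
  shows "sigma_pow \<sigma> r \<alpha> \<circ> (\<sigma> j ^^ k) = (\<sigma> j ^^ k) \<circ> sigma_pow \<sigma> r \<alpha>"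
  using assms(1)
proof (induction r)
  case (Suc r)
  have "(\<sigma> r ^^ \<alpha> r) \<circ> (\<sigma> j ^^ k) = (\<sigma> j ^^ k) \<circ> (\<sigma> r ^^ \<alpha> r)"
    using Suc.prems assms(2) by (intro funpow_commute funpow_commute[symmetric] comm) simp_all
  then show ?case using Suc by (simp add: fun_eq_iff)
qed simp

text \<open>Commutativity of the automorphisms enters here, in reordering the factors. The resulting
  compatibility of exponent addition with composition is what associativity of the skew product
  rests on.\<close>

lemma sigma_pow_add:
  "r \<le> n \<Longrightarrow> sigma_pow \<sigma> r (\<lambda>i. \<alpha> i + \<beta> i) = sigma_pow \<sigma> r \<alpha> \<circ> sigma_pow \<sigma> r \<beta>"
proof (induction r)
  case (Suc r)
  then show ?case using sigma_pow_funpow_commute[of r r \<beta> "\<alpha> r"]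
    by (simp add: fun_eq_iff funpow_add)
qed simp

lemma Sigma_exp_add: "\<Sigma> (\<lambda>i. \<alpha> i + \<beta> i) x = \<Sigma> \<alpha> (\<Sigma> \<beta> x)"
  using sigma_pow_add[of n \<alpha> \<beta>] by simp

lemma sigma_pow_single: "sigma_pow \<sigma> r (single_exp i k) = (if i < r then \<sigma> i ^^ k else id)"
  by (induction r) (auto simp: single_exp_def less_Suc_eq)

lemma Sigma_single: "i < n \<Longrightarrow> \<Sigma> (single_exp i k) = \<sigma> i ^^ k"
  by (simp add: sigma_pow_single)

lemma Sigma_exp_zero [simp]: "\<Sigma> (\<lambda>_. 0) x = x"
proof -
  have "sigma_pow \<sigma> r (\<lambda>_. 0) = id" for r by (induction r) auto
  then show ?thesis by simp
qed

section \<open>The ring structure of skew polynomials\<close>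

abbreviation "C \<equiv> skew_carrier n :: ((nat \<Rightarrow> nat) \<Rightarrow> 'a) set"
abbreviation "mul \<equiv> skew_mult \<sigma> n"

lemma finite_below: "\<gamma> \<in> exps \<Longrightarrow> finite {\<alpha>. \<forall>i. \<alpha> i \<le> \<gamma> i}"
proof (rule finite_subset)
  assume g: "\<gamma> \<in> exps"
  show "{\<alpha>. \<forall>i. \<alpha> i \<le> \<gamma> i} \<subseteq>
      {f. \<forall>i. (i \<in> {..<n} \<longrightarrow> f i \<in> (\<Union>j<n. {..\<gamma> j})) \<and> (i \<notin> {..<n} \<longrightarrow> f i = 0)}"
  proof (intro subsetI CollectI allI conjI impI)
    fix \<alpha> i assume "\<alpha> \<in> {\<alpha>. \<forall>i. \<alpha> i \<le> \<gamma> i}" "i \<notin> {..<n}"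
    then have "\<alpha> i \<le> \<gamma> i" by simp
    moreover have "\<gamma> i = 0" using g \<open>i \<notin> {..<n}\<close> by simp
    ultimately show "\<alpha> i = 0" by simp
  qed auto
  show "finite {f. \<forall>i. (i \<in> {..<n} \<longrightarrow> f i \<in> (\<Union>j<n. {..\<gamma> j})) \<and> (i \<notin> {..<n} \<longrightarrow> f i = 0)}"
    by (rule finite_set_of_finite_funs) auto
qed

lemma C_exps: "p \<in> C \<Longrightarrow> p \<alpha> \<noteq> 0 \<Longrightarrow> \<alpha> \<in> exps"
  by (auto simp: skew_carrier_def)

text \<open>Dropping the support condition makes the index set depend on \<open>\<gamma>\<close>
  alone, so sums for different factors can be compared. It is finite only for exponents that vanish
  from \<open>n\<close> on; outside these, products are treated by
  \<open>skew_mult_outside\<close>.\<close>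

lemma skew_mult_eq:
  assumes "\<gamma> \<in> exps"
  shows "mul p q \<gamma> = (\<Sum>\<alpha>\<in>{\<alpha>. \<forall>i. \<alpha> i \<le> \<gamma> i}. p \<alpha> * \<Sigma> \<alpha> (q (\<lambda>i. \<gamma> i - \<alpha> i)))"
  unfolding skew_mult_def using finite_below[OF assms] by (intro sum.mono_neutral_left) auto

lemma skew_mult_nonzero:
  assumes "mul p q \<gamma> \<noteq> 0"
  shows "\<exists>\<alpha> \<beta>. p \<alpha> \<noteq> 0 \<and> q \<beta> \<noteq> 0 \<and> \<gamma> = (\<lambda>i. \<alpha> i + \<beta> i)"
proof -
  obtain \<alpha> where a: "p \<alpha> \<noteq> 0" "\<forall>i. \<alpha> i \<le> \<gamma> i" "p \<alpha> * \<Sigma> \<alpha> (q (\<lambda>i. \<gamma> i - \<alpha> i)) \<noteq> 0"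
    using assms unfolding skew_mult_def by (elim sum.not_neutral_contains_not_neutral) blast
  then have "q (\<lambda>i. \<gamma> i - \<alpha> i) \<noteq> 0" by auto
  moreover have "\<gamma> = (\<lambda>i. \<alpha> i + (\<gamma> i - \<alpha> i))" using a(2) by auto
  ultimately show ?thesis using a(1) by blast
qed

lemma skew_mult_outside: "p \<in> C \<Longrightarrow> q \<in> C \<Longrightarrow> \<gamma> \<notin> exps \<Longrightarrow> mul p q \<gamma> = 0"
proof (rule ccontr)
  assume *: "p \<in> C" "q \<in> C" "\<gamma> \<notin> exps" "mul p q \<gamma> \<noteq> 0"
  from skew_mult_nonzero[OF *(4)] C_exps[OF *(1)] C_exps[OF *(2)]
  obtain \<alpha> \<beta> where "\<alpha> \<in> exps" "\<beta> \<in> exps" "\<gamma> = (\<lambda>i. \<alpha> i + \<beta> i)" by blast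
  with *(3) show False by auto
qed

lemma skew_mult_closed: "p \<in> C \<Longrightarrow> q \<in> C \<Longrightarrow> mul p q \<in> C"
proof -
  assume pq: "p \<in> C" "q \<in> C"
  have "{\<gamma>. mul p q \<gamma> \<noteq> 0} \<subseteq> (\<lambda>(\<alpha>, \<beta>) i. \<alpha> i + \<beta> i) ` ({\<alpha>. p \<alpha> \<noteq> 0} \<times> {\<beta>. q \<beta> \<noteq> 0})"
  proof
    fix \<gamma> assume "\<gamma> \<in> {\<gamma>. mul p q \<gamma> \<noteq> 0}"
    then obtain \<alpha> \<beta> where "p \<alpha> \<noteq> 0" "q \<beta> \<noteq> 0" "\<gamma> = (\<lambda>i. \<alpha> i + \<beta> i)"
      using skew_mult_nonzero by blast
    then show "\<gamma> \<in> (\<lambda>(\<alpha>, \<beta>) i. \<alpha> i + \<beta> i) ` ({\<alpha>. p \<alpha> \<noteq> 0} \<times> {\<beta>. q \<beta> \<noteq> 0})"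
      by (intro image_eqI[of _ _ "(\<alpha>, \<beta>)"]) auto
  qed
  then have "finite {\<gamma>. mul p q \<gamma> \<noteq> 0}"
    by (rule finite_subset) (use pq in \<open>auto simp: skew_carrier_def\<close>)
  moreover have "\<forall>\<gamma>. mul p q \<gamma> \<noteq> 0 \<longrightarrow> \<gamma> \<in> exps" using skew_mult_outside[OF pq] by blast
  ultimately show ?thesis by (auto simp: skew_carrier_def)
qed

text \<open>Both sides are sums over the ways to split \<open>\<gamma>\<close> into three exponents,
  and the twists agree by \<open>Sigma_exp_add\<close>.\<close>

lemma skew_mult_assoc:
  assumes "p \<in> C" "q \<in> C" "r \<in> C"
  shows "mul (mul p q) r = mul p (mul q r)"
proof
  fix \<gamma>
  show "mul (mul p q) r \<gamma> = mul p (mul q r) \<gamma>"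
  proof (cases "\<gamma> \<in> exps")
    case False
    then show ?thesis using assms by (simp only: skew_mult_outside skew_mult_closed not_False_eq_True)
  next
    case True
    define L where "L \<alpha> = {\<beta>. \<forall>i. \<beta> i \<le> \<alpha> i}" for \<alpha> :: "nat \<Rightarrow> nat"
    have sub: "\<beta> \<in> exps" if "\<beta> \<in> L \<gamma>" for \<beta>
    proof -
      have "\<beta> i = 0" if "n \<le> i" for i
      proof -
        have "\<beta> i \<le> \<gamma> i" using \<open>\<beta> \<in> L \<gamma>\<close> by (simp add: L_def)
        moreover have "\<gamma> i = 0" using True that by simp
        ultimately show ?thesis by simp
      qed
      then show ?thesis by simp
    qed
    have fin: "finite (L \<alpha>)" if "\<alpha> \<in> exps" for \<alpha> using finite_below[OF that] by (simp add: L_def)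
    let ?D = "\<lambda>\<alpha> \<beta> i. \<alpha> i - \<beta> i :: nat"
    have "mul (mul p q) r \<gamma> = (\<Sum>\<alpha>\<in>L \<gamma>. mul p q \<alpha> * \<Sigma> \<alpha> (r (?D \<gamma> \<alpha>)))"
      by (simp add: skew_mult_eq[OF True] L_def)
    also have "\<dots> = (\<Sum>\<alpha>\<in>L \<gamma>. \<Sum>\<beta>\<in>L \<alpha>. p \<beta> * \<Sigma> \<beta> (q (?D \<alpha> \<beta>)) * \<Sigma> \<alpha> (r (?D \<gamma> \<alpha>)))"
      using sub by (intro sum.cong) (auto simp: skew_mult_eq L_def sum_distrib_right)
    also have "\<dots> = (\<Sum>(\<alpha>, \<beta>)\<in>Sigma (L \<gamma>) L. p \<beta> * \<Sigma> \<beta> (q (?D \<alpha> \<beta>)) * \<Sigma> \<alpha> (r (?D \<gamma> \<alpha>)))"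
      using fin[OF True] fin[OF sub] by (intro sum.Sigma) auto
    \<comment> \<open>A chain of exponents from \<open>\<beta>\<close> through
      \<open>\<alpha>\<close> up to \<open>\<gamma>\<close> is encoded by its first term and the
      increment from \<open>\<beta>\<close> to \<open>\<alpha>\<close>; truncated subtraction is
      harmless along such chains.\<close>
    also have "\<dots> = (\<Sum>(\<beta>, \<delta>)\<in>Sigma (L \<gamma>) (\<lambda>\<beta>. L (?D \<gamma> \<beta>)).
        p \<beta> * (\<Sigma> \<beta> (q \<delta>) * \<Sigma> \<beta> (\<Sigma> \<delta> (r (?D (?D \<gamma> \<beta>) \<delta>)))))"
    proof (rule sum.reindex_bij_witness[where i = "\<lambda>(\<beta>, \<delta>). (\<lambda>i. \<beta> i + \<delta> i, \<beta>)"
          and j = "\<lambda>(\<alpha>, \<beta>). (\<beta>, ?D \<alpha> \<beta>)"], goal_cases)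
      case (1 a)
      then show ?case by (auto simp: L_def fun_eq_iff)
    next
      case (2 a)
      then show ?case by (auto simp: L_def intro!: diff_le_mono) (meson le_trans)
    next
      case (3 b)
      then show ?case by (auto simp: L_def fun_eq_iff)
    next
      case (4 b)
      then show ?case by (auto simp: L_def le_diff_conv2 add.commute)
    next
      case (5 a)
      obtain \<alpha> \<beta> where a: "a = (\<alpha>, \<beta>)" by (cases a)
      have le: "\<beta> i \<le> \<alpha> i" "\<alpha> i \<le> \<gamma> i" for i using 5 by (auto simp: a L_def)
      have "\<Sigma> \<beta> (\<Sigma> (?D \<alpha> \<beta>) x) = \<Sigma> \<alpha> x" for x
        using le(1) by (simp add: Sigma_exp_add[symmetric])
      moreover have "?D (?D \<gamma> \<beta>) (?D \<alpha> \<beta>) = ?D \<gamma> \<alpha>" using le by (auto simp: fun_eq_iff)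
      ultimately show ?case by (simp add: a mult.assoc)
    qed
    also have "\<dots> = (\<Sum>\<beta>\<in>L \<gamma>. \<Sum>\<delta>\<in>L (?D \<gamma> \<beta>).
        p \<beta> * (\<Sigma> \<beta> (q \<delta>) * \<Sigma> \<beta> (\<Sigma> \<delta> (r (?D (?D \<gamma> \<beta>) \<delta>)))))"
      using fin[OF True] True by (intro sum.Sigma[symmetric]) (auto intro!: fin)
    also have "\<dots> = (\<Sum>\<beta>\<in>L \<gamma>. p \<beta> * \<Sigma> \<beta> (mul q r (?D \<gamma> \<beta>)))"
      using True by (intro sum.cong refl)
        (simp add: skew_mult_eq L_def Sigma_sum Sigma_mult sum_distrib_left)
    also have "\<dots> = mul p (mul q r) \<gamma>" by (simp add: skew_mult_eq[OF True] L_def)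
    finally show ?thesis .
  qed
qed

lemma skew_monom_closed: "\<alpha> \<in> exps \<Longrightarrow> skew_monom \<alpha> c \<in> C"
  by (auto simp: skew_carrier_def skew_monom_def)

lemma skew_const_eq_monom: "skew_const c = skew_monom (\<lambda>_. 0) c"
  by (simp add: skew_const_def skew_monom_def)

lemma skew_const_closed: "skew_const c \<in> C"
  by (simp add: skew_const_eq_monom skew_monom_closed)

lemma skew_mult_monom_left:
  "mul (skew_monom \<alpha> c) q \<gamma> = (if \<forall>i. \<alpha> i \<le> \<gamma> i then c * \<Sigma> \<alpha> (q (\<lambda>i. \<gamma> i - \<alpha> i)) else 0)"
proof -
  have "{\<beta>. skew_monom \<alpha> c \<beta> \<noteq> 0 \<and> (\<forall>i. \<beta> i \<le> \<gamma> i)} =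
      (if c \<noteq> 0 \<and> (\<forall>i. \<alpha> i \<le> \<gamma> i) then {\<alpha>} else {})"
    by (auto simp: skew_monom_def)
  then show ?thesis unfolding skew_mult_def by (auto simp: skew_monom_def)
qed

lemma skew_mult_monom:
  "mul (skew_monom \<alpha> c) (skew_monom \<beta> e) = skew_monom (\<lambda>i. \<alpha> i + \<beta> i) (c * \<Sigma> \<alpha> e)"
proof
  fix \<gamma>
  have "\<gamma> = (\<lambda>i. \<alpha> i + \<beta> i) \<longleftrightarrow> (\<forall>i. \<alpha> i \<le> \<gamma> i) \<and> (\<lambda>i. \<gamma> i - \<alpha> i) = \<beta>"
    unfolding fun_eq_iff by (metis add_diff_cancel_left' le_add1 le_add_diff_inverse)
  then show "mul (skew_monom \<alpha> c) (skew_monom \<beta> e) \<gamma> = skew_monom (\<lambda>i. \<alpha> i + \<beta> i) (c * \<Sigma> \<alpha> e) \<gamma>"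
    unfolding skew_mult_monom_left by (auto simp: skew_monom_def)
qed

lemma skew_const_mult: "mul (skew_const c) q \<gamma> = c * q \<gamma>"
  by (simp add: skew_const_eq_monom skew_mult_monom_left)

lemma skew_mult_const:
  assumes "p \<in> C"
  shows "mul p (skew_const c) \<gamma> = p \<gamma> * \<Sigma> \<gamma> c"
proof (cases "\<gamma> \<in> exps")
  case True
  have eq: "(\<lambda>i. \<gamma> i - \<alpha> i) = (\<lambda>_. 0) \<longleftrightarrow> \<alpha> = \<gamma>" if "\<forall>i. \<alpha> i \<le> \<gamma> i" for \<alpha>
    using that unfolding fun_eq_iff by (metis diff_is_0_eq diff_self_eq_0 le_antisym)
  have "mul p (skew_const c) \<gamma> = (\<Sum>\<alpha>\<in>{\<alpha>. \<forall>i. \<alpha> i \<le> \<gamma> i}. if \<alpha> = \<gamma> then p \<alpha> * \<Sigma> \<alpha> c else 0)"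
    unfolding skew_mult_eq[OF True] using eq by (intro sum.cong) (auto simp: skew_const_def)
  then show ?thesis using finite_below[OF True] by (simp add: sum.delta)
next
  case False
  then have "p \<gamma> = 0" using C_exps[OF assms] by blast
  then show ?thesis using skew_mult_outside[OF assms skew_const_closed False] by simp
qed

abbreviation "SR \<equiv> skew_poly_ring \<sigma> n"

lemma skew_ring_simps [simp]:
  "carrier SR = C" "p \<otimes>\<^bsub>SR\<^esub> q = mul p q" "p \<oplus>\<^bsub>SR\<^esub> q = (\<lambda>\<alpha>. p \<alpha> + q \<alpha>)"
  "\<one>\<^bsub>SR\<^esub> = skew_const 1" "\<zero>\<^bsub>SR\<^esub> = (\<lambda>_. 0)"
  by (simp_all add: skew_poly_ring_def)

lemma skew_add_closed: "p \<in> C \<Longrightarrow> q \<in> C \<Longrightarrow> (\<lambda>\<alpha>. p \<alpha> + q \<alpha>) \<in> C"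
proof -
  assume pq: "p \<in> C" "q \<in> C"
  have "{\<alpha>. p \<alpha> + q \<alpha> \<noteq> 0} \<subseteq> {\<alpha>. p \<alpha> \<noteq> 0} \<union> {\<alpha>. q \<alpha> \<noteq> 0}" by auto
  then have "finite {\<alpha>. p \<alpha> + q \<alpha> \<noteq> 0}"
    by (rule finite_subset) (use pq in \<open>auto simp: skew_carrier_def\<close>)
  moreover have "\<alpha> \<in> exps" if "p \<alpha> + q \<alpha> \<noteq> 0" for \<alpha>
    using that C_exps[OF pq(1), of \<alpha>] C_exps[OF pq(2), of \<alpha>] by (cases "p \<alpha> = 0") auto
  ultimately show ?thesis by (auto simp: skew_carrier_def)
qed

lemma skew_ring: "ring SR"
proof (rule ringI)
  show "abelian_group SR"
  proof (rule abelian_groupI)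
    show "\<exists>q\<in>carrier SR. q \<oplus>\<^bsub>SR\<^esub> p = \<zero>\<^bsub>SR\<^esub>" if "p \<in> carrier SR" for p
      using that by (intro bexI[of _ "\<lambda>\<alpha>. - p \<alpha>"]) (auto simp: skew_carrier_def)
    show "\<zero>\<^bsub>SR\<^esub> \<in> carrier SR" by (simp add: skew_carrier_def)
  qed (auto simp: skew_add_closed add.assoc add.commute)
  show "monoid SR"
  proof (rule monoidI)
    show "p \<otimes>\<^bsub>SR\<^esub> \<one>\<^bsub>SR\<^esub> = p" if "p \<in> carrier SR" for p
      using that by (simp add: skew_mult_const fun_eq_iff)
    show "\<one>\<^bsub>SR\<^esub> \<otimes>\<^bsub>SR\<^esub> p = p" for p by (simp add: skew_const_mult fun_eq_iff)
  qed (auto simp: skew_mult_closed skew_const_closed skew_mult_assoc)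
  fix p q r assume c: "p \<in> carrier SR" "q \<in> carrier SR" "r \<in> carrier SR"
  show "(p \<oplus>\<^bsub>SR\<^esub> q) \<otimes>\<^bsub>SR\<^esub> r = p \<otimes>\<^bsub>SR\<^esub> r \<oplus>\<^bsub>SR\<^esub> q \<otimes>\<^bsub>SR\<^esub> r"
  proof
    fix \<gamma> show "((p \<oplus>\<^bsub>SR\<^esub> q) \<otimes>\<^bsub>SR\<^esub> r) \<gamma> = (p \<otimes>\<^bsub>SR\<^esub> r \<oplus>\<^bsub>SR\<^esub> q \<otimes>\<^bsub>SR\<^esub> r) \<gamma>"
      using c by (cases "\<gamma> \<in> exps")
        (simp_all add: skew_mult_eq sum.distrib[symmetric] distrib_right skew_mult_outside
          skew_add_closed del: mem_Collect_eq)
  qed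
  show "r \<otimes>\<^bsub>SR\<^esub> (p \<oplus>\<^bsub>SR\<^esub> q) = r \<otimes>\<^bsub>SR\<^esub> p \<oplus>\<^bsub>SR\<^esub> r \<otimes>\<^bsub>SR\<^esub> q"
  proof
    fix \<gamma> show "(r \<otimes>\<^bsub>SR\<^esub> (p \<oplus>\<^bsub>SR\<^esub> q)) \<gamma> = (r \<otimes>\<^bsub>SR\<^esub> p \<oplus>\<^bsub>SR\<^esub> r \<otimes>\<^bsub>SR\<^esub> q) \<gamma>"
      using c by (cases "\<gamma> \<in> exps")
        (simp_all add: skew_mult_eq sum.distrib[symmetric] distrib_left Sigma_add skew_mult_outside
          skew_add_closed del: mem_Collect_eq)
  qed
qed

end

context ring_over_field
begin

lemma monom_prod_single:
  assumes "\<And>i. i < m \<Longrightarrow> a i \<in> carrier R" "k < m"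
  shows "monom_prod R a m (single_exp k 1) = a k"
proof -
  have "monom_prod R a r (single_exp k 1) = (if k < r then a k else \<one>)" if "r \<le> m" for r
    using that by (induction r) (use assms in \<open>auto simp: single_exp_def less_Suc_eq\<close>)
  then show ?thesis using assms by simp
qed

text \<open>\<open>monom_prod\<close> multiplies in the order of the indices, so commutation is
  needed when \<open>k'\<close> precedes \<open>k\<close>. Together with
  \<open>monom_prod_single\<close> this evaluates the monomials of the quadratic relation in
  \<open>pure_pair_dependent\<close>.\<close>

lemma monom_prod_pair:
  assumes "\<And>i. i < m \<Longrightarrow> a i \<in> carrier R" "k < m" "k' < m" "k \<noteq> k'" "a k \<otimes> a k' = a k' \<otimes> a k"
  shows "monom_prod R a m (\<lambda>i. single_exp k 1 i + single_exp k' 1 i) = a k \<otimes> a k'"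
proof -
  have "monom_prod R a r (\<lambda>i. single_exp k 1 i + single_exp k' 1 i) =
      (if k < r then a k else \<one>) \<otimes> (if k' < r then a k' else \<one>)" if "r \<le> m" for r
    using that by (induction r) (use assms in \<open>auto simp: single_exp_def less_Suc_eq\<close>)
  then show ?thesis using assms by simp
qed

end

section \<open>Quotients by proper ideals and sufficiency of equal powers\<close>

context commuting_auts
begin

lemma skew_ring_a_inv: "p \<in> C \<Longrightarrow> \<ominus>\<^bsub>SR\<^esub> p = (\<lambda>\<alpha>. - p \<alpha>)"
proof -
  assume p: "p \<in> C"
  interpret ring SR by (rule skew_ring)
  show ?thesis using p by (intro minus_equality) (auto simp: skew_carrier_def)
qed

lemma single_exp_in_exps: "l < n \<Longrightarrow> single_exp l k \<in> exps"
  by (auto simp: single_exp_def)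

lemma quotient_field_algebra:
  assumes "ideal I SR" "I \<noteq> carrier SR"
  shows "ring_over_field (SR Quot I) (\<lambda>c. I +>\<^bsub>SR\<^esub> skew_const c)"
proof -
  interpret ideal I SR by fact
  interpret Q: ring_hom_ring SR "SR Quot I" "(+>\<^bsub>SR\<^esub>) I" by (rule rcos_ring_hom_ring)
  show ?thesis
  proof unfold_locales
    fix x y :: 'a
    show "I +>\<^bsub>SR\<^esub> skew_const x \<in> carrier (SR Quot I)"
      by (rule Q.hom_closed) (simp add: skew_const_closed)
    have "skew_const (x + y) = skew_const x \<oplus>\<^bsub>SR\<^esub> skew_const y"
      by (auto simp: skew_const_def)
    then show "I +>\<^bsub>SR\<^esub> skew_const (x + y) =
        (I +>\<^bsub>SR\<^esub> skew_const x) \<oplus>\<^bsub>SR Quot I\<^esub> (I +>\<^bsub>SR\<^esub> skew_const y)"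
      using Q.hom_add[of "skew_const x" "skew_const y"] by (simp add: skew_const_closed del: skew_ring_simps(3))
    have "skew_const (x * y) = skew_const x \<otimes>\<^bsub>SR\<^esub> skew_const y"
      by (simp add: skew_const_eq_monom skew_mult_monom)
    then show "I +>\<^bsub>SR\<^esub> skew_const (x * y) =
        (I +>\<^bsub>SR\<^esub> skew_const x) \<otimes>\<^bsub>SR Quot I\<^esub> (I +>\<^bsub>SR\<^esub> skew_const y)"
      using Q.hom_mult[of "skew_const x" "skew_const y"] by (simp add: skew_const_closed del: skew_ring_simps(2))
    show "I +>\<^bsub>SR\<^esub> skew_const 1 = \<one>\<^bsub>SR Quot I\<^esub>" using Q.hom_one by simp
    show "\<one>\<^bsub>SR Quot I\<^esub> \<noteq> \<zero>\<^bsub>SR Quot I\<^esub>"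
    proof
      assume "\<one>\<^bsub>SR Quot I\<^esub> = \<zero>\<^bsub>SR Quot I\<^esub>"
      then have "I +>\<^bsub>SR\<^esub> \<one>\<^bsub>SR\<^esub> = I" by (simp add: FactRing_def)
      then have "\<one>\<^bsub>SR\<^esub> \<in> I" using a_rcos_self[of "\<one>\<^bsub>SR\<^esub>"] one_closed by simp
      then show False using one_imp_carrier assms(2) by blast
    qed
  qed
qed

text \<open>Classes of monomials are reached by induction on the total degree, splitting off one
  variable on the right; general classes follow by removing one exponent of the support at a
  time.\<close>

lemma quotient_generated:
  assumes "ideal I SR"
  shows "carrier (SR Quot I) \<subseteq> generate_ring (SR Quot I)
     (range (\<lambda>c. I +>\<^bsub>SR\<^esub> skew_const c) \<union> (\<lambda>i. I +>\<^bsub>SR\<^esub> skew_monom (single_exp i 1) 1) ` {..<n})"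
    (is "_ \<subseteq> generate_ring ?Q ?H")
proof -
  interpret ideal I SR by fact
  interpret Q: ring_hom_ring SR "SR Quot I" "(+>\<^bsub>SR\<^esub>) I" by (rule rcos_ring_hom_ring)
  let ?c = "\<lambda>p. I +>\<^bsub>SR\<^esub> p"
  have monom: "?c (skew_monom \<alpha> c) \<in> generate_ring ?Q ?H" if "\<alpha> \<in> exps" for \<alpha> c
    using that
  proof (induction "\<Sum>i<n. \<alpha> i" arbitrary: \<alpha>)
    case 0
    then have "\<alpha> i = 0" for i by (cases "i < n") auto
    then have "\<alpha> = (\<lambda>_. 0)" by auto
    then show ?case by (auto simp: skew_const_eq_monom[symmetric] intro!: generate_ring.incl)
  next
    case (Suc N)
    then obtain i where i: "i < n" "\<alpha> i \<noteq> 0"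
      by (metis lessThan_iff nat.distinct(1) sum.neutral)
    define \<beta> where "\<beta> = \<alpha>(i := \<alpha> i - 1)"
    have \<beta>: "\<beta> \<in> exps" using Suc.prems i by (auto simp: \<beta>_def)
    have \<alpha>: "\<alpha> = (\<lambda>k. \<beta> k + single_exp i 1 k)" using i by (auto simp: \<beta>_def single_exp_def)
    have "(\<Sum>k<n. \<alpha> k) = (\<Sum>k<n. \<beta> k) + (\<Sum>k<n. single_exp i 1 k)"
      by (subst \<alpha>) (simp add: sum.distrib)
    also have "(\<Sum>k<n. single_exp i 1 k) = 1" using i by (simp add: single_exp_def)
    finally have "?c (skew_monom \<beta> c) \<in> generate_ring ?Q ?H" using Suc \<beta> by simp
    moreover have "?c (skew_monom (single_exp i 1) 1) \<in> generate_ring ?Q ?H"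
      using i by (auto intro!: generate_ring.incl)
    moreover have "skew_monom \<alpha> c = skew_monom \<beta> c \<otimes>\<^bsub>SR\<^esub> skew_monom (single_exp i 1) 1"
      by (subst \<alpha>) (simp add: skew_mult_monom)
    then have "?c (skew_monom \<alpha> c) = ?c (skew_monom \<beta> c) \<otimes>\<^bsub>?Q\<^esub> ?c (skew_monom (single_exp i 1) 1)"
      using i \<beta> by (simp only: Q.hom_mult skew_ring_simps(1) skew_monom_closed single_exp_in_exps)
    ultimately show ?case by (simp add: generate_ring.eng_mult)
  qed
  have "?c p \<in> generate_ring ?Q ?H" if "finite A" "p \<in> C" "{\<alpha>. p \<alpha> \<noteq> 0} \<subseteq> A" for A p
    using that
  proof (induction A arbitrary: p)
    case empty
    then have "p = skew_monom (\<lambda>_. 0) 0" by (auto simp: skew_monom_def)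
    then show ?case using monom[of "\<lambda>_. 0" 0] by simp
  next
    case (insert \<alpha> A)
    show ?case
    proof (cases "p \<alpha> = 0")
      case True
      then show ?thesis using insert.prems by (intro insert.IH) auto
    next
      case False
      then have \<alpha>: "\<alpha> \<in> exps" using C_exps insert.prems by blast
      define q where "q = p(\<alpha> := 0)"
      have "{\<beta>. q \<beta> \<noteq> 0} \<subseteq> {\<beta>. p \<beta> \<noteq> 0}" by (auto simp: q_def)
      then have q: "q \<in> C" using insert.prems(1) unfolding skew_carrier_def
        by (auto intro: finite_subset)
      have "p = q \<oplus>\<^bsub>SR\<^esub> skew_monom \<alpha> (p \<alpha>)" by (auto simp: q_def skew_monom_def)
      then have "?c p = ?c q \<oplus>\<^bsub>?Q\<^esub> ?c (skew_monom \<alpha> (p \<alpha>))"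
        using Q.hom_add[of q "skew_monom \<alpha> (p \<alpha>)"] q \<alpha>
        by (simp del: skew_ring_simps(3) add: skew_monom_closed)
      moreover have "?c q \<in> generate_ring ?Q ?H"
      proof (rule insert.IH[OF q])
        show "{\<beta>. q \<beta> \<noteq> 0} \<subseteq> A" using insert.prems by (auto simp: q_def)
      qed
      ultimately show ?thesis using monom[OF \<alpha>] by (simp add: generate_ring.eng_add)
    qed
  qed
  then have "?c p \<in> generate_ring ?Q ?H" if "p \<in> C" for p
    using that unfolding skew_carrier_def by blast
  then show ?thesis by (auto simp: FactRing_def A_RCOSETS_def')
qed

lemma aut_normalizable_tuple_of_equal_powers:
  assumes inf: "infinite {x. \<forall>i<n. \<sigma> i x = x}"
    and d: "\<And>i. i < n \<Longrightarrow> 0 < d i" "\<And>i j. i < n \<Longrightarrow> j < n \<Longrightarrow> \<sigma> i ^^ d i = \<sigma> j ^^ d j"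
  shows "aut_normalizable_tuple \<sigma> n"
  unfolding aut_normalizable_tuple_def
proof (intro allI impI, elim conjE)
  fix I assume I: "ideal I SR" "I \<noteq> carrier SR"
  interpret ideal I SR by fact
  interpret Q: ring_hom_ring SR "SR Quot I" "(+>\<^bsub>SR\<^esub>) I" by (rule rcos_ring_hom_ring)
  interpret A: ring_over_field "SR Quot I" "\<lambda>c. I +>\<^bsub>SR\<^esub> skew_const c"
    by (rule quotient_field_algebra[OF I])
  let ?x = "\<lambda>i. I +>\<^bsub>SR\<^esub> skew_monom (single_exp i 1) 1"
  have x: "skew_monom (single_exp i 1) 1 \<in> carrier SR" if "i < n" for i
    unfolding skew_ring_simps using that by (intro skew_monom_closed single_exp_in_exps)
  \<comment> \<open>For \<open>n = 0\<close> there is no \<open>\<sigma> 0\<close> to take a power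
    of. The identity serves, since the hypothesis then says that the field is infinite.\<close>
  define \<tau> where "\<tau> = (if n = 0 then id else \<sigma> 0 ^^ d 0)"
  show "aut_normalizable (SR Quot I) (\<lambda>c. I +>\<^bsub>SR\<^esub> skew_const c)"
  proof (rule A.aut_normalizable_of_equal_powers[of n ?x \<sigma> d \<tau>])
    fix i j assume ij: "i < n" "j < n"
    have "skew_monom (single_exp i 1) 1 \<otimes>\<^bsub>SR\<^esub> skew_monom (single_exp j 1) 1 =
        skew_monom (single_exp j 1) 1 \<otimes>\<^bsub>SR\<^esub> skew_monom (single_exp i 1) (1::'a)"
      by (simp add: skew_mult_monom add.commute)
    then show "?x i \<otimes>\<^bsub>SR Quot I\<^esub> ?x j = ?x j \<otimes>\<^bsub>SR Quot I\<^esub> ?x i"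
      using Q.hom_mult[OF x[OF ij(1)] x[OF ij(2)]] Q.hom_mult[OF x[OF ij(2)] x[OF ij(1)]] by metis
  next
    fix i assume i: "i < n"
    show "?x i \<in> carrier (SR Quot I)" using x[OF i] by (rule Q.hom_closed)
    show "automorphic (SR Quot I) (\<lambda>c. I +>\<^bsub>SR\<^esub> skew_const c) (?x i) (\<sigma> i)"
      unfolding automorphic_def
    proof
      fix b
      have c: "skew_const e \<in> carrier SR" for e by (simp add: skew_const_closed)
      have "skew_monom (single_exp i 1) 1 \<otimes>\<^bsub>SR\<^esub> skew_const b =
          skew_const (\<sigma> i b) \<otimes>\<^bsub>SR\<^esub> skew_monom (single_exp i 1) 1"
        using i by (simp add: skew_const_eq_monom skew_mult_monom Sigma_single)
      then show "?x i \<otimes>\<^bsub>SR Quot I\<^esub> (I +>\<^bsub>SR\<^esub> skew_const b) =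
          (I +>\<^bsub>SR\<^esub> skew_const (\<sigma> i b)) \<otimes>\<^bsub>SR Quot I\<^esub> ?x i"
        using Q.hom_mult[OF x[OF i] c] Q.hom_mult[OF c x[OF i]] by metis
    qed
    show "0 < d i" using d(1) i .
    show "\<sigma> i ^^ d i = \<tau>" unfolding \<tau>_def using d(2)[of i 0] i by auto
  next
    show "field_aut \<tau>"
      using Sigma_aut[of "single_exp 0 (d 0)"] by (auto simp: \<tau>_def Sigma_single field_aut_def)
    have "(\<sigma> 0 ^^ k) x = x" if "\<sigma> 0 x = x" for k x using that by (induction k) auto
    then have "{x. \<forall>i<n. \<sigma> i x = x} \<subseteq> {c. \<tau> c = c}" by (auto simp: \<tau>_def)
    then show "infinite {c. \<tau> c = c}" using inf infinite_super by blast
  next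
    show "carrier (SR Quot I) \<subseteq> A.gen ?x n" by (rule quotient_generated[OF I(1)])
  qed
qed

end

section \<open>Necessity of equal powers\<close>

lemma single_exp_zero: "single_exp l 0 = (\<lambda>_. 0)"
  by (auto simp: single_exp_def)

lemma single_exp_eq_iff: "single_exp l p = single_exp l q \<longleftrightarrow> p = q"
  by (auto simp: single_exp_def fun_eq_iff)

text \<open>A power of one variable factors only into powers of the same variable. This is why
  \<open>cross_ideal\<close> absorbs multiplication on both sides.\<close>

lemma single_exp_split:
  assumes "(\<lambda>i. \<alpha> i + \<beta> i) = single_exp l k"
  shows "\<alpha> = single_exp l (\<alpha> l)" "\<beta> = single_exp l (\<beta> l)"
  using assms by (auto simp: single_exp_def fun_eq_iff split: if_splits)

context commuting_auts
begin

text \<open>The quotient by this ideal is \<open>F[t_i, t_j; \<sigma>_i, \<sigma>_j] / (t_i t_j)\<close>.\<close>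

definition cross_ideal :: "nat \<Rightarrow> nat \<Rightarrow> ((nat \<Rightarrow> nat) \<Rightarrow> 'a) set" where
  "cross_ideal i j = {p \<in> C. \<forall>l\<in>{i, j}. \<forall>k. p (single_exp l k) = 0}"

text \<open>The coefficients of a product at powers of one variable depend only on such coefficients
  of the factors. Keeping just these coefficients is thus a multiplicative projection onto the skew
  polynomials in that variable.\<close>

lemma skew_mult_single:
  assumes "l < n"
  shows "mul p q (single_exp l N) =
    (\<Sum>k\<le>N. p (single_exp l k) * (\<sigma> l ^^ k) (q (single_exp l (N - k))))"
proof -
  have "{\<alpha>. \<forall>i. \<alpha> i \<le> single_exp l N i} = single_exp l ` {..N}"
  proof (intro equalityI subsetI)
    fix \<alpha> assume a: "\<alpha> \<in> {\<alpha>. \<forall>i. \<alpha> i \<le> single_exp l N i}"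
    then have le: "\<alpha> i \<le> single_exp l N i" for i by blast
    have "\<alpha> = single_exp l (\<alpha> l)"
    proof
      fix i show "\<alpha> i = single_exp l (\<alpha> l) i" using le[of i] by (auto simp: single_exp_def)
    qed
    moreover have "\<alpha> l \<le> N" using le[of l] by (simp add: single_exp_def)
    ultimately show "\<alpha> \<in> single_exp l ` {..N}" by blast
  qed (auto simp: single_exp_def)
  moreover have "inj_on (single_exp l) {..N}" by (auto simp: inj_on_def single_exp_eq_iff)
  moreover have "(\<lambda>i. single_exp l N i - single_exp l k i) = single_exp l (N - k)" for k
    by (auto simp: single_exp_def)
  ultimately show ?thesis
    unfolding skew_mult_eq[OF single_exp_in_exps[OF assms]]
    by (simp add: sum.reindex Sigma_single[OF assms])
qed

section \<open>Two variables whose product is zero\<close>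

context
  fixes i j :: nat
  assumes ij: "i < n" "j < n" "i \<noteq> j"
begin

abbreviation "J \<equiv> cross_ideal i j"
abbreviation "Q \<equiv> SR Quot J"
abbreviation cl :: "((nat \<Rightarrow> nat) \<Rightarrow> 'a) \<Rightarrow> ((nat \<Rightarrow> nat) \<Rightarrow> 'a) set" where
  "cl p \<equiv> J +>\<^bsub>SR\<^esub> p"

lemma cross_ideal_mult:
  assumes "p \<in> C" "q \<in> C" "p \<in> J \<or> q \<in> J"
  shows "mul p q \<in> J"
proof -
  have "mul p q (single_exp l k) = 0" if l: "l \<in> {i, j}" for l k
  proof (rule ccontr)
    assume "mul p q (single_exp l k) \<noteq> 0"
    then obtain \<alpha> \<beta> where ab: "p \<alpha> \<noteq> 0" "q \<beta> \<noteq> 0" "single_exp l k = (\<lambda>i. \<alpha> i + \<beta> i)"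
      using skew_mult_nonzero by blast
    then have "p (single_exp l (\<alpha> l)) \<noteq> 0" "q (single_exp l (\<beta> l)) \<noteq> 0"
      using single_exp_split[OF ab(3)[symmetric]] by metis+
    then show False using assms(3) l unfolding cross_ideal_def by blast
  qed
  then show ?thesis using skew_mult_closed assms by (auto simp: cross_ideal_def)
qed

lemma cross_ideal: "ideal J SR"
proof (rule idealI)
  interpret ring SR by (rule skew_ring)
  show "ring SR" by (rule skew_ring)
  show "subgroup J (add_monoid SR)"
  proof (rule add.subgroupI)
    show "J \<noteq> {}" by (auto simp: cross_ideal_def skew_carrier_def intro!: exI[of _ "\<lambda>_. 0"])
    show "\<ominus>\<^bsub>SR\<^esub> p \<in> J" if "p \<in> J" for p
    proof -
      have "p \<in> C" using that by (simp add: cross_ideal_def)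
      then have "\<ominus>\<^bsub>SR\<^esub> p \<in> C" using a_inv_closed by simp
      then show ?thesis using that \<open>p \<in> C\<close> by (simp add: skew_ring_a_inv cross_ideal_def)
    qed
  qed (auto simp: cross_ideal_def skew_add_closed)
  fix p q assume "p \<in> J" "q \<in> carrier SR"
  moreover from this have "p \<in> C" "q \<in> C" by (simp_all add: cross_ideal_def)
  ultimately show "q \<otimes>\<^bsub>SR\<^esub> p \<in> J" "p \<otimes>\<^bsub>SR\<^esub> q \<in> J"
    by (simp_all add: cross_ideal_mult)
qed

text \<open>Coefficients at powers of the two chosen variables are invariants of the class, so they
  can be read off from any representative; \<open>cl_zero\<close> says that there are no further
  invariants.\<close>

lemma cl_coeff:
  assumes "p \<in> C" "q \<in> C" "cl p = cl q" "l \<in> {i, j}"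
  shows "p (single_exp l k) = q (single_exp l k)"
proof -
  interpret ideal J SR by (rule cross_ideal)
  have "p \<in> cl q" using a_rcos_self[of p] assms by simp
  then obtain h where h: "h \<in> J" "p = h \<oplus>\<^bsub>SR\<^esub> q" by (auto simp: a_r_coset_def')
  then show ?thesis using assms(4) by (auto simp: cross_ideal_def)
qed

lemma cl_zero:
  assumes "p \<in> C" "\<And>l k. l \<in> {i, j} \<Longrightarrow> p (single_exp l k) = 0"
  shows "cl p = \<zero>\<^bsub>Q\<^esub>"
proof -
  interpret ideal J SR by (rule cross_ideal)
  have "p \<in> J" using assms by (auto simp: cross_ideal_def)
  then show ?thesis by (simp add: a_rcos_const FactRing_def)
qed

lemma cl_ops:
  assumes "p \<in> C" "q \<in> C"
  shows "cl p \<otimes>\<^bsub>Q\<^esub> cl q = cl (mul p q)" "cl p \<oplus>\<^bsub>Q\<^esub> cl q = cl (\<lambda>\<alpha>. p \<alpha> + q \<alpha>)"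
    "\<ominus>\<^bsub>Q\<^esub> cl p = cl (\<lambda>\<alpha>. - p \<alpha>)" "cl p \<in> carrier Q"
proof -
  interpret ideal J SR by (rule cross_ideal)
  interpret Q: ring_hom_ring SR Q cl by (rule rcos_ring_hom_ring)
  show "cl p \<otimes>\<^bsub>Q\<^esub> cl q = cl (mul p q)" "cl p \<oplus>\<^bsub>Q\<^esub> cl q = cl (\<lambda>\<alpha>. p \<alpha> + q \<alpha>)"
    using Q.hom_mult[of p q] Q.hom_add[of p q] assms by simp_all
  show "\<ominus>\<^bsub>Q\<^esub> cl p = cl (\<lambda>\<alpha>. - p \<alpha>)"
    using Q.hom_a_inv[of p] skew_ring_a_inv[of p] assms by simp
  show "cl p \<in> carrier Q" using Q.hom_closed[of p] assms by simp
qed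

lemma cl_surj: "Y \<in> carrier Q \<Longrightarrow> \<exists>p\<in>C. Y = cl p"
  by (auto simp: FactRing_def A_RCOSETS_def')

lemma cross_ideal_proper: "J \<noteq> carrier SR"
proof
  assume "J = carrier SR"
  then have "skew_const 1 \<in> J" using skew_const_closed by simp
  then have "skew_const 1 (single_exp i 0) = (0::'a)" unfolding cross_ideal_def by blast
  then show False by (simp add: skew_const_def single_exp_zero)
qed

lemma uminus_closed: "p \<in> C \<Longrightarrow> (\<lambda>\<alpha>. - p \<alpha>) \<in> C"
  by (auto simp: skew_carrier_def)

text \<open>Under the projection to skew polynomials in the variable of index \<open>l\<close>, the
  generated subring becomes the field of constants. A module finitely generated over constants
  involves only finitely many powers of that variable, so some power is missed.\<close>

lemma not_finite_over_pure:
  assumes l: "l \<in> {i, j}" and A: "\<And>k. k < m \<Longrightarrow> A k \<in> C"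
    and pure: "\<And>k N. k < m \<Longrightarrow> 0 < N \<Longrightarrow> A k (single_exp l N) = 0"
  shows "\<not> finite_over Q (generate_ring Q (range (\<lambda>c. cl (skew_const c)) \<union> (\<lambda>k. cl (A k)) ` {..<m}))"
proof
  let ?H = "range (\<lambda>c. cl (skew_const c)) \<union> (\<lambda>k. cl (A k)) ` {..<m}"
  have ln: "l < n" using l ij by auto
  interpret ideal J SR by (rule cross_ideal)
  interpret Q: ring_hom_ring SR Q cl by (rule rcos_ring_hom_ring)
  \<comment> \<open>The classes whose projection is constant. They form a subring, and it contains
    all the generators.\<close>
  define T where "T = {cl p | p. p \<in> C \<and> (\<forall>N>0. p (single_exp l N) = 0)}"
  have const: "skew_const c (single_exp l N) = 0" if "0 < N" for c :: 'a and N
    using that single_exp_eq_iff[of l N 0] by (simp add: skew_const_def single_exp_zero)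
  have T_const: "cl (skew_const c) \<in> T" for c
    unfolding T_def using const skew_const_closed by blast
  have gen_T: "r \<in> T" if "r \<in> generate_ring Q ?H" for r
    using that
  proof induction
    case one
    show ?case using T_const[of 1] Q.hom_one by simp
  next
    case (incl h)
    then show ?case using T_const A pure by (auto simp: T_def)
  next
    case (a_inv h)
    then obtain p where p: "h = cl p" "p \<in> C" "\<forall>N>0. p (single_exp l N) = 0" by (auto simp: T_def)
    then show ?case unfolding T_def using uminus_closed[OF p(2)]
      by (auto simp: cl_ops intro!: exI[of _ "\<lambda>\<alpha>. - p \<alpha>"])
  next
    case (eng_add h1 h2)
    then obtain p q where p: "h1 = cl p" "p \<in> C" "\<forall>N>0. p (single_exp l N) = 0"
      and q: "h2 = cl q" "q \<in> C" "\<forall>N>0. q (single_exp l N) = 0" by (auto simp: T_def)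
    then show ?case unfolding T_def using skew_add_closed[OF p(2) q(2)]
      by (auto simp: cl_ops intro!: exI[of _ "\<lambda>\<alpha>. p \<alpha> + q \<alpha>"])
  next
    case (eng_mult h1 h2)
    then obtain p q where p: "h1 = cl p" "p \<in> C" "\<forall>N>0. p (single_exp l N) = 0"
      and q: "h2 = cl q" "q \<in> C" "\<forall>N>0. q (single_exp l N) = 0" by (auto simp: T_def)
    have "mul p q (single_exp l N) = 0" if "0 < N" for N
      unfolding skew_mult_single[OF ln]
    proof (rule sum.neutral, rule ballI)
      fix k assume "k \<in> {..N}"
      show "p (single_exp l k) * (\<sigma> l ^^ k) (q (single_exp l (N - k))) = 0"
        using p(3) q(3) that by (cases "k = 0") auto
    qed
    then show ?case unfolding T_def using skew_mult_closed[OF p(2) q(2)] p q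
      by (auto simp: cl_ops intro!: exI[of _ "mul p q"])
  qed
  assume "finite_over Q (generate_ring Q ?H)"
  then obtain G where G: "finite G" "G \<subseteq> carrier Q"
    "\<And>s. s \<in> carrier Q \<Longrightarrow> \<exists>r. (\<forall>g\<in>G. r g \<in> generate_ring Q ?H) \<and> s = finsum Q (\<lambda>g. r g \<otimes>\<^bsub>Q\<^esub> g) G"
    unfolding finite_over_def by blast
  obtain B where B: "\<And>g. g \<in> G \<Longrightarrow> B g \<in> C \<and> g = cl (B g)"
    using cl_surj G(2) by (metis subsetD)
  have "finite {N. B g (single_exp l N) \<noteq> 0}" if "g \<in> G" for g
  proof (rule finite_imageD)
    show "finite (single_exp l ` {N. B g (single_exp l N) \<noteq> 0})"
      by (rule finite_subset[of _ "{\<alpha>. B g \<alpha> \<noteq> 0}"]) (use B[OF that] in \<open>auto simp: skew_carrier_def\<close>)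
  qed (auto simp: inj_on_def single_exp_eq_iff)
  \<comment> \<open>The exponent \<open>N\<close> is chosen so that its power of the variable occurs
    in none of the representatives \<open>B g\<close> of the module generators.\<close>
  then have "finite (insert 0 (\<Union>g\<in>G. {N. B g (single_exp l N) \<noteq> 0}))" using G(1) by simp
  from ex_new_if_finite[OF infinite_UNIV_nat this]
  obtain N where N: "\<And>g. g \<in> G \<Longrightarrow> B g (single_exp l N) = 0" by auto
  let ?y = "skew_monom (single_exp l N) (1::'a)"
  have y: "?y \<in> C" using ln by (intro skew_monom_closed single_exp_in_exps)
  obtain r where r: "\<And>g. g \<in> G \<Longrightarrow> r g \<in> generate_ring Q ?H" "cl ?y = finsum Q (\<lambda>g. r g \<otimes>\<^bsub>Q\<^esub> g) G"
    using G(3)[of "cl ?y"] cl_ops(4)[OF y y] by auto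
  \<comment> \<open>Multiplying on the left by an element with constant projection only scales the
    coefficient of \<open>g\<close> at the exponent \<open>N\<close>, and that coefficient is
    zero.\<close>
  have summand: "\<exists>p\<in>C. r g \<otimes>\<^bsub>Q\<^esub> g = cl p \<and> p (single_exp l N) = 0" if g: "g \<in> G" for g
  proof -
    obtain p where p: "r g = cl p" "p \<in> C" "\<forall>N>0. p (single_exp l N) = 0"
      using gen_T[OF r(1)[OF g]] by (auto simp: T_def)
    have "mul p (B g) (single_exp l N) = 0"
      unfolding skew_mult_single[OF ln]
    proof (rule sum.neutral, rule ballI)
      fix k assume "k \<in> {..N}"
      show "p (single_exp l k) * (\<sigma> l ^^ k) (B g (single_exp l (N - k))) = 0"
        using p(3) N[OF g] by (cases "k = 0") auto
    qed
    moreover have "r g \<otimes>\<^bsub>Q\<^esub> g = cl (mul p (B g))"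
      using cl_ops(1)[of p "B g"] p B[OF g] by simp
    ultimately show ?thesis using skew_mult_closed[of p "B g"] p B[OF g] by blast
  qed
  have "\<exists>p\<in>C. finsum Q (\<lambda>g. r g \<otimes>\<^bsub>Q\<^esub> g) G' = cl p \<and> p (single_exp l N) = 0" if "finite G'" "G' \<subseteq> G" for G'
    using that
  proof (induction G')
    case empty
    have z: "(\<lambda>_. 0) \<in> C" by (simp add: skew_carrier_def)
    show ?case using cl_zero[OF z] z by (intro bexI[of _ "\<lambda>_. 0"]) simp_all
  next
    case (insert g G')
    obtain p q where p: "p \<in> C" "finsum Q (\<lambda>g. r g \<otimes>\<^bsub>Q\<^esub> g) G' = cl p" "p (single_exp l N) = 0"
      and q: "q \<in> C" "r g \<otimes>\<^bsub>Q\<^esub> g = cl q" "q (single_exp l N) = 0"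
      using insert summand[of g] by auto
    have "r h \<otimes>\<^bsub>Q\<^esub> h \<in> carrier Q" if "h \<in> G" for h
      using summand[OF that] cl_ops(4) by auto
    then have "finsum Q (\<lambda>g. r g \<otimes>\<^bsub>Q\<^esub> g) (insert g G') = cl q \<oplus>\<^bsub>Q\<^esub> cl p"
      unfolding p(2)[symmetric] q(2)[symmetric] using insert.hyps insert.prems
      by (intro Q.S.finsum_insert) auto
    also have "\<dots> = cl (\<lambda>\<alpha>. q \<alpha> + p \<alpha>)" by (rule cl_ops(2)[OF q(1) p(1)])
    finally show ?case using skew_add_closed[OF q(1) p(1)] p(3) q(3)
      by (intro bexI[of _ "\<lambda>\<alpha>. q \<alpha> + p \<alpha>"]) auto
  qed
  from this[OF G(1) order_refl] obtain p where "p \<in> C" "cl ?y = cl p" "p (single_exp l N) = 0"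
    using r(2) by auto
  with cl_coeff[OF y _ _ l, of p N] show False by (simp add: skew_monom_def)
qed

text \<open>With \<open>p0\<close> and \<open>q0\<close> the constant terms of \<open>p = A k\<close> and \<open>q = A k'\<close>, the product \<open>(p - p0) (q - q0)\<close>
  lies in the ideal, and moving the scalars to the left gives a monic relation.\<close>

lemma pure_pair_dependent:
  assumes l: "{l, l'} = {i, j}" and k: "k < m" "k' < m" "k \<noteq> k'"
    and A: "\<And>k. k < m \<Longrightarrow> A k \<in> C"
    and comm: "cl (A k) \<otimes>\<^bsub>Q\<^esub> cl (A k') = cl (A k') \<otimes>\<^bsub>Q\<^esub> cl (A k)"
    and aut: "\<And>h N. h \<in> {i, j} \<Longrightarrow> A k (single_exp h N) \<noteq> 0 \<Longrightarrow> \<tau> = \<sigma> h ^^ N"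
    and pure: "\<And>N. 0 < N \<Longrightarrow> A k (single_exp l N) = 0" "\<And>N. 0 < N \<Longrightarrow> A k' (single_exp l' N) = 0"
  shows "\<not> left_alg_indep Q (\<lambda>c. cl (skew_const c)) (\<lambda>k. cl (A k)) m"
proof
  assume indep: "left_alg_indep Q (\<lambda>c. cl (skew_const c)) (\<lambda>k. cl (A k)) m"
  interpret ideal J SR by (rule cross_ideal)
  interpret Q: ring_hom_ring SR Q cl by (rule rcos_ring_hom_ring)
  interpret A: ring_over_field Q "\<lambda>c. cl (skew_const c)"
    by (rule quotient_field_algebra[OF cross_ideal cross_ideal_proper])
  define p where "p = A k"
  define q where "q = A k'"
  define p0 where "p0 = p (\<lambda>_. 0)"
  define q0 where "q0 = q (\<lambda>_. 0)"
  have pC: "p \<in> C" and qC: "q \<in> C" using A k by (auto simp: p_def q_def)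
  have ln: "l < n" "l' < n" and l_in: "l \<in> {i, j}" "l' \<in> {i, j}" using l ij by auto
  let ?e = "\<lambda>k. single_exp k 1 :: nat \<Rightarrow> nat"
  let ?ee = "\<lambda>h. ?e k h + ?e k' h"
  let ?S = "{?ee, ?e k', ?e k, \<lambda>_. 0}"
  \<comment> \<open>Writing \<open>a\<close> and \<open>b\<close> for the two classes, the product
    of \<open>a - p0\<close> and \<open>b - q0\<close> expands to
    \<open>a b - p0 b - \<tau>(q0) a + p0 q0\<close>, since moving \<open>q0\<close> to the left of
    \<open>a\<close> turns it into \<open>\<tau> q0\<close>.\<close>
  define c where "c \<alpha> = (if \<alpha> = ?ee then 1 else if \<alpha> = ?e k' then - p0 else
      if \<alpha> = ?e k then - \<tau> q0 else if \<alpha> = (\<lambda>_. 0) then p0 * q0 else 0)" for \<alpha>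
  have sep: "\<alpha> \<noteq> \<beta>" if "\<alpha> h \<noteq> \<beta> h" for \<alpha> \<beta> :: "nat \<Rightarrow> nat" and h using that by auto
  \<comment> \<open>The four exponents must be distinct for \<open>c\<close> to have the intended
    values; in particular its value at the mixed exponent is then 1.\<close>
  have dist: "?ee \<noteq> ?e k'" "?ee \<noteq> ?e k" "?ee \<noteq> (\<lambda>_. 0)" "?e k' \<noteq> ?e k" "?e k' \<noteq> (\<lambda>_. 0)" "?e k \<noteq> (\<lambda>_. 0)"
    using k(3) by (intro sep[of _ k] sep[of _ k']; simp add: single_exp_def)+
  have c_simps: "c ?ee = 1" "c (?e k') = - p0" "c (?e k) = - \<tau> q0" "c (\<lambda>_. 0) = p0 * q0"
    unfolding c_def using dist by (simp_all only: if_True if_False not_sym refl simp_thms)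
  have c_sub: "{\<alpha>. c \<alpha> \<noteq> 0} \<subseteq> ?S" by (auto simp: c_def split: if_splits)
  let ?t = "\<lambda>\<alpha>. cl (skew_const (c \<alpha>)) \<otimes>\<^bsub>Q\<^esub> monom_prod Q (\<lambda>k. cl (A k)) m \<alpha>"
  have clA: "cl (A h) \<in> carrier Q" if "h < m" for h using cl_ops(4)[OF A[OF that] A[OF that]] .
  have mono: "monom_prod Q (\<lambda>k. cl (A k)) m ?ee = cl p \<otimes>\<^bsub>Q\<^esub> cl q"
      "monom_prod Q (\<lambda>k. cl (A k)) m (?e k') = cl q" "monom_prod Q (\<lambda>k. cl (A k)) m (?e k) = cl p"
    using A.monom_prod_pair[of m "\<lambda>k. cl (A k)" k k'] A.monom_prod_single[of m "\<lambda>k. cl (A k)"]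
      clA k comm by (simp_all add: p_def q_def)
  have mono0: "monom_prod Q (\<lambda>k. cl (A k)) r (\<lambda>_. 0) = \<one>\<^bsub>Q\<^esub>" if "r \<le> m" for r
    using that by (induction r) (auto simp: clA)
  define f1 where "f1 = mul p q"
  define f2 where "f2 = mul (skew_const (- p0)) q"
  define f3 where "f3 = mul (skew_const (- \<tau> q0)) p"
  define f4 where "f4 = (skew_const (p0 * q0) :: (nat \<Rightarrow> nat) \<Rightarrow> 'a)"
  have fC: "f1 \<in> C" "f2 \<in> C" "f3 \<in> C" "f4 \<in> C"
    using pC qC by (simp_all add: f1_def f2_def f3_def f4_def skew_mult_closed skew_const_closed)
  have clc: "cl (skew_const x) \<in> carrier Q" for x by (rule A.hom_closed)
  have terms: "?t ?ee = cl f1" "?t (?e k') = cl f2" "?t (?e k) = cl f3" "?t (\<lambda>_. 0) = cl f4"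
    unfolding c_simps mono mono0[OF order_refl]
    using cl_ops(1)[OF pC qC] cl_ops(1)[OF skew_const_closed qC] cl_ops(1)[OF skew_const_closed pC]
      cl_ops(4)[OF fC(1) fC(1)] clc A.hom_one
    by (simp_all add: f1_def f2_def f3_def f4_def)
  have tc: "?t \<in> ?S \<rightarrow> carrier Q" using terms cl_ops(4) fC by auto
  \<comment> \<open>Some of the four scalars may vanish, so the support of \<open>c\<close> can be
    smaller than \<open>?S\<close>. Adding the zero terms gives a sum of fixed shape.\<close>
  have "finsum Q ?t {\<alpha>. c \<alpha> \<noteq> 0} = finsum Q ?t ?S"
  proof (rule Q.S.add.finprod_mono_neutral_cong_left)
    fix \<alpha> assume a: "\<alpha> \<in> ?S - {\<alpha>. c \<alpha> \<noteq> 0}"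
    have "cl p \<in> carrier Q" "cl q \<in> carrier Q" using cl_ops(4) pC qC by blast+
    moreover have "\<alpha> = ?ee \<or> \<alpha> = ?e k' \<or> \<alpha> = ?e k \<or> \<alpha> = (\<lambda>_. 0)" using a by blast
    ultimately have "monom_prod Q (\<lambda>k. cl (A k)) m \<alpha> \<in> carrier Q"
      using mono mono0[OF order_refl] by (elim disjE) (simp_all only: Q.S.m_closed Q.S.one_closed)
    then show "?t \<alpha> = \<zero>\<^bsub>Q\<^esub>" using a A.hom_zero by simp
  qed (use c_sub tc in auto)
  also have "\<dots> = ?t ?ee \<oplus>\<^bsub>Q\<^esub> (?t (?e k') \<oplus>\<^bsub>Q\<^esub> (?t (?e k) \<oplus>\<^bsub>Q\<^esub> ?t (\<lambda>_. 0)))"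
    using dist tc by (simp add: Pi_iff)
  also have "\<dots> = cl (\<lambda>\<alpha>. f1 \<alpha> + (f2 \<alpha> + (f3 \<alpha> + f4 \<alpha>)))"
    unfolding terms by (simp add: cl_ops fC skew_add_closed)
  also have "\<dots> = \<zero>\<^bsub>Q\<^esub>"
  proof (rule cl_zero)
    show "(\<lambda>\<alpha>. f1 \<alpha> + (f2 \<alpha> + (f3 \<alpha> + f4 \<alpha>))) \<in> C" by (intro skew_add_closed fC)
    have [simp]: "p (single_exp h 0) = p0" "q (single_exp h 0) = q0" for h
      by (simp_all add: p0_def q0_def single_exp_zero)
    \<comment> \<open>A nonzero constant term forces \<open>\<tau>\<close> to be the zeroth power of
      an automorphism, that is the identity. Hence the constant terms of the relation cancel in
      either case.\<close>
    have \<tau>0: "p0 = 0 \<or> \<tau> q0 = q0"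
      using aut[OF l_in(1), of 0] by (cases "p0 = 0") (simp_all add: p_def[symmetric])
    have f_simps: "f2 \<alpha> = - p0 * q \<alpha>" "f3 \<alpha> = - \<tau> q0 * p \<alpha>"
        "f4 \<alpha> = (if \<alpha> = (\<lambda>_. 0) then p0 * q0 else 0)" for \<alpha>
      by (simp_all only: f2_def f3_def f4_def skew_const_mult) (simp add: skew_const_def)
    fix h and N :: nat assume "h \<in> {i, j}"
    \<comment> \<open>At positive powers of the variable \<open>l\<close> the element
      \<open>p\<close> vanishes and the first two terms cancel; at those of \<open>l'\<close> the
      element \<open>q\<close> vanishes and the first and third cancel; the constant term is
      left.\<close>
    then consider "h = l" "N > 0" | "h = l'" "N > 0" | "N = 0" using l by blast
    then show "f1 (single_exp h N) + (f2 (single_exp h N) + (f3 (single_exp h N) + f4 (single_exp h N))) = 0"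
    proof cases
      case 1
      have "f1 (single_exp h N) = (\<Sum>k\<le>N. if k = 0 then p0 * q (single_exp l N) else 0)"
        unfolding f1_def 1(1) skew_mult_single[OF ln(1)] using pure(1)
        by (intro sum.cong) (auto simp: p_def[symmetric])
      then show ?thesis using 1 pure(1) single_exp_eq_iff[of l N 0]
        by (simp add: f_simps p_def[symmetric] single_exp_zero)
    next
      case 2
      have "f1 (single_exp h N) = (\<Sum>k\<le>N. if k = N then p (single_exp l' N) * (\<sigma> l' ^^ N) q0 else 0)"
        unfolding f1_def 2(1) skew_mult_single[OF ln(2)]
      proof (intro sum.cong refl)
        fix k assume "k \<in> {..N}"
        then have "(\<sigma> l' ^^ k) (q (single_exp l' (N - k))) = 0" if "k \<noteq> N"
          using pure(2)[of "N - k"] that Sigma_single[OF ln(2), of k] Sigma_0[of "single_exp l' k"]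
          by (simp add: q_def[symmetric])
        then show "p (single_exp l' k) * (\<sigma> l' ^^ k) (q (single_exp l' (N - k))) =
            (if k = N then p (single_exp l' N) * (\<sigma> l' ^^ N) q0 else 0)" by simp
      qed
      then have "f1 (single_exp h N) = p (single_exp l' N) * (\<sigma> l' ^^ N) q0" by simp
      also have "\<dots> = p (single_exp l' N) * \<tau> q0"
        using aut[OF l_in(2), of N] by (auto simp: p_def[symmetric])
      finally show ?thesis using 2 pure(2) single_exp_eq_iff[of l' N 0]
        by (simp add: f_simps q_def[symmetric] single_exp_zero)
    next
      case 3
      have "f1 (single_exp h N) = p0 * q0"
        using skew_mult_single[OF ln(1), of p q 0] unfolding f1_def 3 by (simp add: single_exp_zero p0_def q0_def)
      then show ?thesis using 3 \<tau>0
        by (auto simp: f_simps single_exp_zero p0_def q0_def)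
    qed
  qed
  finally have "finsum Q ?t {\<alpha>. c \<alpha> \<noteq> 0} = \<zero>\<^bsub>Q\<^esub>" .
  moreover have "finite {\<alpha>. c \<alpha> \<noteq> 0}" using c_sub by (rule finite_subset) simp
  moreover have "\<forall>\<alpha>. c \<alpha> \<noteq> 0 \<longrightarrow> (\<forall>i\<ge>m. \<alpha> i = 0)"
  proof (intro allI impI)
    fix \<alpha> h assume "c \<alpha> \<noteq> 0" "m \<le> h"
    from \<open>c \<alpha> \<noteq> 0\<close> have "\<alpha> \<in> ?S" using c_sub by blast
    moreover have "h \<noteq> k" "h \<noteq> k'" using k \<open>m \<le> h\<close> by auto
    ultimately show "\<alpha> h = 0" by (auto simp: single_exp_def)
  qed
  ultimately have "\<forall>\<alpha>. c \<alpha> = 0" using indep unfolding left_alg_indep_def by blast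
  then show False using c_simps(1) by simp
qed

lemma equal_powers_pair:
  assumes "aut_normalizable_tuple \<sigma> n"
  shows "\<exists>p>0. \<exists>q>0. \<sigma> i ^^ p = \<sigma> j ^^ q"
proof (rule ccontr)
  assume no: "\<not> ?thesis"
  have "aut_normalizable Q (\<lambda>c. cl (skew_const c))"
    using assms cross_ideal cross_ideal_proper unfolding aut_normalizable_tuple_def by blast
  then obtain m a \<tau> where a: "\<And>k. k < m \<Longrightarrow> a k \<in> carrier Q"
      "\<And>k k'. k < m \<Longrightarrow> k' < m \<Longrightarrow> a k \<otimes>\<^bsub>Q\<^esub> a k' = a k' \<otimes>\<^bsub>Q\<^esub> a k"
      "\<And>k. k < m \<Longrightarrow> automorphic Q (\<lambda>c. cl (skew_const c)) (a k) (\<tau> k)"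
      "left_alg_indep Q (\<lambda>c. cl (skew_const c)) a m"
      "finite_over Q (generate_ring Q (range (\<lambda>c. cl (skew_const c)) \<union> a ` {..<m}))"
    unfolding aut_normalizable_def
    apply (elim exE conjE)
    subgoal for m a \<tau> by (rule that[of m a \<tau>]) blast+
    done
  have "\<forall>k. \<exists>p. k < m \<longrightarrow> p \<in> C \<and> a k = cl p" using cl_surj a(1) by blast
  from choice[OF this] obtain A where A0: "\<And>k. k < m \<Longrightarrow> A k \<in> C \<and> a k = cl (A k)" by blast
  have A: "A k \<in> C" "a k = cl (A k)" if "k < m" for k using A0[OF that] by auto
  \<comment> \<open>Compare the coefficients at the \<open>N\<close>-th power of the variable
    \<open>h\<close> on both sides of the automorphic identity for \<open>a k\<close> and cancel the
    nonzero one. The case \<open>N = 0\<close> is included, as \<open>pure_pair_dependent\<close>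
    uses it for constant terms.\<close>
  have aut: "\<tau> k = \<sigma> h ^^ N" if k: "k < m" and h: "h \<in> {i, j}" and nz: "A k (single_exp h N) \<noteq> 0" for k h N
  proof
    fix b
    have hn: "h < n" using h ij by auto
    have "cl (mul (A k) (skew_const b)) = cl (mul (skew_const (\<tau> k b)) (A k))"
      using a(3)[OF k] A[OF k] cl_ops(1) skew_const_closed by (simp add: automorphic_def)
    from cl_coeff[OF skew_mult_closed skew_mult_closed this h, of N] A[OF k] skew_const_closed
    have "A k (single_exp h N) * (\<sigma> h ^^ N) b = \<tau> k b * A k (single_exp h N)"
      by (simp add: skew_mult_const skew_const_mult Sigma_single[OF hn])
    then show "\<tau> k b = (\<sigma> h ^^ N) b" using nz by simp
  qed
  \<comment> \<open>Here \<open>l\<close> is the variable that is absent: apart from the constant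
    term, \<open>A k\<close> has no power of it.\<close>
  define pure where "pure l k \<longleftrightarrow> (\<forall>N>0. A k (single_exp l N) = 0)" for l k
  have pure: "pure i k \<or> pure j k" if "k < m" for k
  proof (rule ccontr)
    assume "\<not> (pure i k \<or> pure j k)"
    then obtain p q where "p > 0" "A k (single_exp i p) \<noteq> 0" "q > 0" "A k (single_exp j q) \<noteq> 0"
      by (auto simp: pure_def)
    then have "\<sigma> i ^^ p = \<sigma> j ^^ q" using aut[OF that, of i p] aut[OF that, of j q] by simp
    with no \<open>p > 0\<close> \<open>q > 0\<close> show False by blast
  qed
  have im: "a ` {..<m} = (\<lambda>k. cl (A k)) ` {..<m}" using A(2) by auto
  have not_all: "\<not> (\<forall>k<m. pure l k)" if "l \<in> {i, j}" for l
    using not_finite_over_pure[OF that, of m A] A(1) a(5) unfolding im pure_def by blast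
  \<comment> \<open>Failure of purity for \<open>j\<close> gives an index that must be pure for
    \<open>i\<close>, and failure for \<open>i\<close> gives one that must be pure for
    \<open>j\<close>. Being of opposite kinds, the two indices differ.\<close>
  obtain k k' where k: "k < m" "\<not> pure j k" "k' < m" "\<not> pure i k'" using not_all by blast
  then have p: "pure i k" "pure j k'" using pure by auto
  then have "k \<noteq> k'" using k by auto
  \<comment> \<open>The families \<open>a\<close> and \<open>A\<close> are related only below
    \<open>m\<close>, so independence is transferred through the monomials, which involve no further
    indices.\<close>
  have "left_alg_indep Q (\<lambda>c. cl (skew_const c)) (\<lambda>k. cl (A k)) m"
  proof -
    have "monom_prod Q a r \<alpha> = monom_prod Q (\<lambda>k. cl (A k)) r \<alpha>" if "r \<le> m" for r \<alpha>
      using that by (induction r) (auto simp: A(2))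
    then have "monom_prod Q a m = monom_prod Q (\<lambda>k. cl (A k)) m" by blast
    then show ?thesis using a(4) unfolding left_alg_indep_def by (simp only:)
  qed
  moreover have "cl (A k) \<otimes>\<^bsub>Q\<^esub> cl (A k') = cl (A k') \<otimes>\<^bsub>Q\<^esub> cl (A k)"
    using a(2)[OF k(1,3)] unfolding A(2)[OF k(1)] A(2)[OF k(3)] .
  moreover note pure_pair_dependent[of i j k m k' A "\<tau> k", OF refl k(1,3) \<open>k \<noteq> k'\<close> A(1)]
  ultimately show False using aut[OF k(1)] p unfolding pure_def by metis
qed

end

text \<open>Each \<open>\<sigma> i\<close> is compared with \<open>\<sigma> 0\<close> only, giving
  exponents \<open>p i\<close> and \<open>q i\<close>. Multiplying \<open>p i\<close> by all
  \<open>q k\<close> with \<open>k\<close> different from \<open>i\<close> raises every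
  \<open>\<sigma> i\<close> to the same power of \<open>\<sigma> 0\<close>, namely the one whose
  exponent is the product of all the \<open>q k\<close>.\<close>

lemma equal_powers:
  assumes "aut_normalizable_tuple \<sigma> n"
  shows "\<exists>d. (\<forall>i<n. 0 < d i) \<and> (\<forall>i<n. \<forall>j<n. \<sigma> i ^^ d i = \<sigma> j ^^ d j)"
proof -
  have "\<exists>p q. p > 0 \<and> q > 0 \<and> \<sigma> i ^^ p = \<sigma> 0 ^^ q" if "i < n" for i
    using equal_powers_pair[OF that _ _ assms, of 0] that by (cases "i = 0") (auto intro: exI[of _ 1])
  then obtain p q where pq: "\<And>i. i < n \<Longrightarrow> p i > 0 \<and> q i > 0 \<and> \<sigma> i ^^ p i = \<sigma> 0 ^^ q i" by metis
  define d where "d i = p i * (\<Prod>k\<in>{..<n} - {i}. q k)" for i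
  have "0 < d i" if "i < n" for i
    using pq that by (auto simp: d_def intro!: prod_pos)
  moreover have "\<sigma> i ^^ d i = \<sigma> 0 ^^ (\<Prod>k<n. q k)" if "i < n" for i
  proof -
    have "\<sigma> i ^^ d i = (\<sigma> i ^^ p i) ^^ (\<Prod>k\<in>{..<n} - {i}. q k)" by (simp add: d_def funpow_mult)
    also have "\<dots> = \<sigma> 0 ^^ (q i * (\<Prod>k\<in>{..<n} - {i}. q k))" using pq[OF that] by (simp add: funpow_mult)
    also have "q i * (\<Prod>k\<in>{..<n} - {i}. q k) = (\<Prod>k<n. q k)"
      using that by (simp add: prod.remove[of "{..<n}" i])
    finally show ?thesis .
  qed
  ultimately show ?thesis by (intro exI[of _ d]) auto
qed

end

theorem theorem5p13:
  fixes \<sigma> :: "nat \<Rightarrow> 'a::field \<Rightarrow> 'a" and n :: nat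
  assumes "\<forall>i<n. field_aut (\<sigma> i)"
    and "\<forall>i<n. \<forall>j<n. \<sigma> i \<circ> \<sigma> j = \<sigma> j \<circ> \<sigma> i"
    and "infinite {x. \<forall>i<n. \<sigma> i x = x}"
  shows "aut_normalizable_tuple \<sigma> n \<longleftrightarrow>
         (\<exists>d :: nat \<Rightarrow> nat. (\<forall>i<n. 0 < d i) \<and> (\<forall>i<n. \<forall>j<n. \<sigma> i ^^ d i = \<sigma> j ^^ d j))"
proof -
  interpret commuting_auts \<sigma> n
    using assms(1,2) by unfold_locales auto
  show ?thesis
    using equal_powers aut_normalizable_tuple_of_equal_powers[OF assms(3)] by blast
qed

end
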